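(* Write $n(s):=n_4(5,2;s)$. The following bounds and exact values hold. (1) For $2\le s\le 21$: $20\le n(2)\le 22$; $39\le n(3)\le 42$; $n(4)=64$; $75\le n(5)\le 77$; $90\le n(6)\le 94$; $107\le n(7)\le 111$; $n(8)=128$; $n(9)=141$; $156\le n(10)\le 158$; $n(11)=175$; $n(12)=192$; $n(13)=205$; $n(14)=222$; $n(15)=239$; $n(16)=256$; $n(17)=273$; $n(18)=290$; $n(19)=307$; $n(20)=324$; $n(21)=341$. (2) For every integer $t\ge 2$: $n(21t-20)=341t-328$; $n(21t-19)=341t-311$; $n(21t-18)=341t-294$; $n(21t-17)=341t-277$; $n(21t-16)=341t-264$; $n(21t-15)=341t-247$; $n(21t-14)=341t-230$; $n(21t-13)=341t-213$; $n(21t-12)=341t-200$; $n(21t-11)=341t-183$; $n(21t-10)=341t-166$; $n(21t-9)=341t-149$; $n(21t-8)=341t-136$; $n(21t-7)=341t-119$; $n(21t-6)=341t-102$; $n(21t-5)=341t-85$; $n(21t-4)=341t-68$; $n(21t-3)=341t-51$; $n(21t-2)=341t-34$; $n(21t-1)=341t-17$; $n(21t)=341t$.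
   Context: All dimensions are vector-space dimensions; a hyperplane of $\mathbb{F}_q^r$ is an $(r-1)$-dimensional subspace. A projective $h-(n,r,s)_q$ system is a multiset of $n$ subspaces of $\mathbb{F}_q^r$, each of dimension at most $h$, such that each hyperplane contains at most $s$ of these subspaces (counted with multiplicity) and some hyperplane contains exactly $s$ of them. $n_q(r,h;s)$ denotes the maximum $n$ such that a projective $h-(n,r,s)_q$ system exists. *)

theory Defs
  imports "HOL-Analysis.Analysis" "HOL-Library.Multiset"
begin

text \<open>
  The ambient space \<open>F_q^r\<close> is \<^typ>\<open>'q ^ 'r\<close> for a finite field type \<^typ>\<open>'q\<close> with \<open>q\<close> elements
  and an index type \<^typ>\<open>'r\<close> with \<open>r\<close> elements.
\<close>

definition hyperplane :: "('q::field ^ 'r) set \<Rightarrow> bool" where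
  "hyperplane H \<longleftrightarrow> vec.subspace H \<and> vec.dim H = CARD('r) - 1"

definition subspaces_in :: "('q::field ^ 'r) set multiset \<Rightarrow> ('q ^ 'r) set \<Rightarrow> nat" where
  "subspaces_in M H = size {#U \<in># M. U \<subseteq> H#}"

definition projective_system :: "nat \<Rightarrow> nat \<Rightarrow> nat \<Rightarrow> ('q::{field,finite} ^ 'r) set multiset \<Rightarrow> bool" where
  "projective_system h n s M \<longleftrightarrow>
     size M = n \<and>
     (\<forall>U \<in># M. vec.subspace U \<and> vec.dim U \<le> h) \<and>
     (\<forall>H. hyperplane H \<longrightarrow> subspaces_in M H \<le> s) \<and>
     (\<exists>H. hyperplane H \<and> subspaces_in M H = s)"

text \<open>
  For \<open>h < r\<close> the set below is finite, since every member of a system lies in some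
  hyperplane, and nonempty, since it contains \<open>s\<close> (take \<open>s\<close> copies of the zero subspace).
  For \<open>h \<ge> r\<close> it is infinite, because copies of the whole space can be added freely, and
  the value is unspecified.
\<close>

definition max_system_size :: "'q::{field,finite} itself \<Rightarrow> 'r::finite itself \<Rightarrow> nat \<Rightarrow> nat \<Rightarrow> nat" where
  "max_system_size _ _ h s =
     Max {n. \<exists>M :: ('q ^ 'r) set multiset. projective_system h n s M}"

end

theory Submission
  imports Defs
begin

text \<open>
  Replacing every member by a line containing it only lowers the hyperplane counts. The points of
  \<open>n\<close> lines then form a quaternary linear code of length \<open>5n\<close>, dimension \<open>5\<close> and minimum distance at
  least \<open>4(n - s)\<close>, and for \<open>s \<ge> 4\<close> the Griesmer bound for this code is the stated upper bound.
  For \<open>s = 2, 3\<close> one counts instead the other lines in the 21 hyperplanes through a fixed line;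
  for \<open>s = 3\<close> equality is excluded by a divisibility argument.

  The union of systems with parameters \<open>(s, n)\<close> and \<open>(s', n')\<close> satisfies the bound for
  \<open>(s + s', n + n')\<close>. So all lower bounds, including those of part (2) by repeatedly adding
  341 lines with \<open>s = 21\<close>, follow from fifteen explicit line systems. The remaining condition that
  some hyperplane contains exactly \<open>s\<close> members is met by shrinking members to the zero subspace.
\<close>

section \<open>Hyperplanes and linear functionals\<close>

text \<open>A line outside a hyperplane meets it in one of its 5 points, so a functional is nonzero
  at 4 points of every line on which it does not vanish; hence the distance \<open>4(n - s)\<close>.
  The first two Griesmer terms \<open>4(n - s)\<close> and \<open>n - s\<close> add up to
  \<open>5(n - s)\<close>. Against the length \<open>5n\<close> this leaves \<open>5s\<close> as a
  bound for the other three terms, the iterated ceilings of \<open>(n - s) / 4\<close>.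

  The numbers 21 and 341 count the points of a plane and of the whole space. As 341 = 21 + 4 * 80
  and 80 + 20 + 5 = 5 * 21, the Griesmer bound is periodic in this step. For s = 1, 2, 3 it gives
  only 13, 30, 47, which counting shows to be out of reach; yet 341 more than these are the true
  values for s = 22, 23, 24. So part (2) is exact for every residue, but its start t = 2 needs sums
  of its own.

  The field is an arbitrary type with four elements. The explicit systems are therefore written over
  the concrete datatype \<open>gf4\<close> and transported. Their counts over the 341 hyperplanes
  are evaluated by rewriting, which makes the cost of the check a concern.\<close>

definition dotp :: "'q::field ^ 'r \<Rightarrow> 'q ^ 'r \<Rightarrow> 'q" where
  "dotp x v = (\<Sum>i\<in>UNIV. x $ i * v $ i)"

definition perp :: "'q::field ^ 'r \<Rightarrow> ('q ^ 'r) set" where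
  "perp x = {v. dotp x v = 0}"

lemma dotp_simps [simp]:
  "dotp 0 v = 0" "dotp x 0 = 0"
  "dotp (x + y) v = dotp x v + dotp y v" "dotp x (v + u) = dotp x v + dotp x u"
  "dotp (x - y) v = dotp x v - dotp y v" "dotp x (v - u) = dotp x v - dotp x u"
  "dotp (c *s x) v = c * dotp x v" "dotp x (c *s v) = c * dotp x v"
  by (simp_all add: dotp_def algebra_simps sum.distrib sum_subtractf sum_distrib_left)

lemma dotp_axis [simp]: "dotp x (axis i c) = x $ i * c"
proof -
  have "dotp x (axis i c) = (\<Sum>j\<in>UNIV. if j = i then x $ j * c else 0)"
    unfolding dotp_def by (rule sum.cong) (auto simp: axis_def)
  then show ?thesis
    by simp
qed

lemma subspace_perp [simp]: "vec.subspace (perp x)"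
  by (rule vec.subspaceI) (simp_all add: perp_def)

lemma hyperplane_perp:
  fixes x :: "'q::field ^ 'r"
  assumes "x \<noteq> 0"
  shows "hyperplane (perp x)"
proof -
  obtain i where i: "x $ i \<noteq> 0"
    using assms by (auto simp: vec_eq_iff)
  define v where "v = axis i (1 / x $ i)"
  have v: "dotp x v = 1"
    using i by (simp add: v_def)
  have sp: "vec.span (perp x) = perp x"
    by (simp add: vec.span_eq_iff)
  have "v \<notin> vec.span (perp x)"
    unfolding sp using v by (simp add: perp_def)
  then have "vec.dim (insert v (perp x)) = vec.dim (perp x) + 1"
    by (simp add: vec.dim_insert)
  moreover have "vec.span (insert v (perp x)) = UNIV"
  proof (rule UNIV_eq_I[symmetric])
    fix u
    have "u - dotp x u *s v \<in> perp x"
      by (simp add: perp_def v)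
    then show "u \<in> vec.span (insert v (perp x))"
      by (metis sp vec.span_breakdown_eq)
  qed
  then have "vec.dim (insert v (perp x)) = CARD('r)"
    by (metis vec.dim_span vec_dim_card)
  ultimately show ?thesis
    by (simp add: hyperplane_def)
qed

lemma separating_functional:
  fixes v :: "'q::field ^ 'r"
  assumes "vec.subspace W" "v \<notin> W"
  obtains x where "W \<subseteq> perp x" "dotp x v = 1"
proof -
  obtain B where B: "B \<subseteq> W" "vec.independent B" "W \<subseteq> vec.span B"
    using vec.basis_exists by metis
  have WB: "W = vec.span B"
    using B assms(1) by (metis vec.span_subspace)
  then have v: "v \<notin> vec.span B"
    using assms(2) by simp
  then have "vec.independent (insert v B)"
    using B(2) by (rule vec.independent_insertI)
  \<comment> \<open>The extended map goes from the space to itself: \<open>v\<close> is sent to a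
    unit vector at an arbitrary coordinate, and reading off that coordinate turns \<open>f\<close>
    into the functional \<open>x\<close>.\<close>
  then obtain f :: "'q ^ 'r \<Rightarrow> 'q ^ 'r"
    where f: "Vector_Spaces.linear (*s) (*s) f"
      and fB: "\<forall>u\<in>insert v B. f u = (if u = v then axis undefined 1 else 0)"
    using vec.linear_independent_extend[of "insert v B" "\<lambda>u. if u = v then axis undefined 1 else 0"]
    by blast
  interpret f: Vector_Spaces.linear "(*s)" "(*s)" f
    by (rule f)
  define x where "x = (\<chi> i. f (axis i 1) $ undefined)"
  have x: "dotp x u = f u $ undefined" for u
    using linear_componentwise[OF f, of u undefined]
    by (simp add: dotp_def x_def mult.commute)
  have "v \<notin> B"
    using v vec.span_base by blast
  then have "B \<subseteq> perp x"
    using fB by (auto simp: perp_def x)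
  then have "W \<subseteq> perp x"
    unfolding WB by (rule vec.span_minimal) simp
  moreover have "dotp x v = 1"
    using fB by (simp add: x)
  ultimately show thesis
    by (rule that)
qed

lemma hyperplane_imp_perp:
  fixes H :: "('q::field ^ 'r) set"
  assumes "hyperplane H"
  obtains x where "x \<noteq> 0" "H = perp x"
proof -
  have H: "vec.subspace H" "vec.dim H = CARD('r) - 1"
    using assms by (auto simp: hyperplane_def)
  have "H \<noteq> UNIV"
    using H(2) by (metis One_nat_def diff_less less_irrefl vec_dim_card zero_less_card_finite zero_less_one)
  then obtain v where "v \<notin> H"
    by blast
  then obtain x where x: "H \<subseteq> perp x" "dotp x v = 1"
    using separating_functional[OF H(1)] by metis
  have "x \<noteq> 0"
    using x(2) by auto
  moreover from this have "H = perp x"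
    using x(1) H hyperplane_perp[of x] by (intro vec.subspace_dim_equal) (auto simp: hyperplane_def)
  ultimately show thesis
    by (rule that)
qed

text \<open>The condition that some hyperplane attains \<open>s\<close> is dropped because unions do
  not preserve it; \<open>projective_system_of_bounded\<close> restores it.\<close>

definition bounded_system :: "nat \<Rightarrow> nat \<Rightarrow> ('q::field ^ 'r) set multiset \<Rightarrow> bool" where
  "bounded_system h s M \<longleftrightarrow>
     (\<forall>U \<in># M. vec.subspace U \<and> vec.dim U \<le> h) \<and> (\<forall>H. hyperplane H \<longrightarrow> subspaces_in M H \<le> s)"

lemma bounded_system_iff_perp:
  "bounded_system h s M \<longleftrightarrow>
     (\<forall>U \<in># M. vec.subspace U \<and> vec.dim U \<le> h) \<and> (\<forall>x. x \<noteq> 0 \<longrightarrow> subspaces_in M (perp x) \<le> s)"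
  unfolding bounded_system_def by (metis hyperplane_perp hyperplane_imp_perp)

text \<open>Replacing members by the zero subspace one at a time raises the maximum of
  \<^const>\<open>subspaces_in\<close> over the hyperplanes in steps of at most one, so it hits \<open>s\<close>.\<close>

lemma projective_system_of_bounded:
  fixes M :: "('q::{field,finite} ^ 'r) set multiset"
  assumes "bounded_system h s M" "s \<le> size M"
  obtains N :: "('q ^ 'r) set multiset" where "projective_system h (size M) s N"
  using assms
proof (induction "size {#U \<in># M. U \<noteq> {0}#}" arbitrary: M thesis rule: less_induct)
  case less
  have M: "\<And>U. U \<in># M \<Longrightarrow> vec.subspace U \<and> vec.dim U \<le> h"
      "\<And>H. hyperplane H \<Longrightarrow> subspaces_in M H \<le> s"
    using less.prems(2) by (auto simp: bounded_system_def)
  show ?case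
  proof (cases "\<exists>H. hyperplane H \<and> subspaces_in M H = s")
    case True
    then have "projective_system h (size M) s M"
      using M by (auto simp: projective_system_def)
    then show ?thesis
      by (rule less.prems(1))
  next
    case False
    have lt: "subspaces_in M H < s" if "hyperplane H" for H
      using M(2)[OF that] False that by (metis le_neq_implies_less)
    have "\<exists>U \<in># M. U \<noteq> {0}"
    proof (rule ccontr)
      assume "\<not> ?thesis"
      then have all: "U = {0}" if "U \<in># M" for U
        using that by blast
      \<comment> \<open>The zero subspace lies in every hyperplane, so any one hyperplane would
        already count all of \<open>M\<close>, hence at least \<open>s\<close> members.\<close>
      have H: "hyperplane (perp (axis undefined (1 :: 'q) :: 'q ^ 'r))"
        by (rule hyperplane_perp) (simp add: axis_eq_0_iff)
      have "subspaces_in M (perp (axis undefined (1 :: 'q) :: 'q ^ 'r)) = size M"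
        unfolding subspaces_in_def
        by (rule arg_cong[where f = size], rule filter_mset_eq_conv[THEN iffD2])
          (auto simp: perp_def dest!: all)
      with lt[OF H] less.prems(3) show False
        by simp
    qed
    then obtain U N where U: "U \<noteq> {0}" "M = add_mset U N"
      by (metis mset_add)
    have "bounded_system h s (add_mset {0} N)"
      unfolding bounded_system_def
    proof (intro conjI ballI allI impI)
      fix V assume "V \<in># add_mset {0} N"
      then show "vec.subspace V" "vec.dim V \<le> h"
        using M(1)[of V] by (auto simp: U vec.dim_eq_0[THEN iffD2])
    next
      fix H :: "('q ^ 'r) set"
      assume H: "hyperplane H"
      show "subspaces_in (add_mset {0} N) H \<le> s"
        using lt[OF H] by (auto simp: U subspaces_in_def split: if_splits)
    qed
    then show ?thesis
      using less.hyps[of "add_mset {0} N"] less.prems(1,3) U by auto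
  qed
qed

text \<open>\<open>Max\<close> is meaningful only on a finite nonempty set: \<open>upper\<close>
  supplies finiteness and \<open>M\<close> a member.\<close>

lemma max_system_size_bounds:
  fixes M :: "('q::{field,finite} ^ 'r) set multiset"
  assumes upper: "\<And>N :: ('q ^ 'r) set multiset. bounded_system h s N \<Longrightarrow> size N \<le> u"
    and M: "bounded_system h s M" "s \<le> size M"
  shows "size M \<le> max_system_size TYPE('q) TYPE('r) h s"
    and "max_system_size TYPE('q) TYPE('r) h s \<le> u"
proof -
  let ?S = "{n. \<exists>N :: ('q ^ 'r) set multiset. projective_system h n s N}"
  have le: "n \<le> u" if "n \<in> ?S" for n
    using that upper by (auto simp: projective_system_def bounded_system_def)
  have fin: "finite ?S"
    by (rule finite_subset[of _ "{..u}"]) (use le in auto)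
  have mem: "size M \<in> ?S"
    using projective_system_of_bounded[OF M] by blast
  show "size M \<le> max_system_size TYPE('q) TYPE('r) h s"
    unfolding max_system_size_def using fin mem by (rule Max_ge)
  show "max_system_size TYPE('q) TYPE('r) h s \<le> u"
    unfolding max_system_size_def using fin mem le by (subst Max_le_iff) auto
qed

section \<open>Systems of lines\<close>

definition vanishes :: "'q::field ^ 'r \<Rightarrow> ('q ^ 'r) \<times> ('q ^ 'r) \<Rightarrow> bool" where
  "vanishes x l \<longleftrightarrow> dotp x (fst l) = 0 \<and> dotp x (snd l) = 0"

text \<open>Pairs may be dependent; they then span a smaller subspace, still an admissible member.
  Independence enters in the counts for \<open>s = 2, 3\<close>.\<close>

definition line_system :: "nat \<Rightarrow> (('q::field ^ 'r) \<times> ('q ^ 'r)) list \<Rightarrow> bool" where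
  "line_system s ls \<longleftrightarrow> (\<forall>x. x \<noteq> 0 \<longrightarrow> length (filter (vanishes x) ls) \<le> s)"

lemma line_system_append:
  "line_system s ls \<Longrightarrow> line_system t ms \<Longrightarrow> line_system (s + t) (ls @ ms)"
  by (auto simp: line_system_def intro: add_mono)

lemma vanishes_iff_span: "vanishes x l \<longleftrightarrow> vec.span {fst l, snd l} \<subseteq> perp x"
proof
  assume "vanishes x l"
  then show "vec.span {fst l, snd l} \<subseteq> perp x"
    by (intro vec.span_minimal subspace_perp) (auto simp: vanishes_def perp_def)
next
  assume "vec.span {fst l, snd l} \<subseteq> perp x"
  then have "{fst l, snd l} \<subseteq> perp x"
    using vec.span_superset by blast
  then show "vanishes x l"
    by (simp add: vanishes_def perp_def)
qed

lemma bounded_system_of_lines: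
  fixes ls :: "(('q::field ^ 'r) \<times> ('q ^ 'r)) list"
  assumes "line_system s ls"
  shows "bounded_system 2 s (mset (map (\<lambda>l. vec.span {fst l, snd l}) ls))"
proof -
  have "vec.dim (vec.span {a, b}) \<le> 2" for a b :: "'q ^ 'r"
  proof -
    have "vec.dim (vec.span {a, b}) \<le> card {a, b}"
      by (rule vec.dim_le_card) auto
    also have "\<dots> \<le> 2"
      by (simp add: card_insert_if)
    finally show ?thesis .
  qed
  moreover have "subspaces_in (mset (map (\<lambda>l. vec.span {fst l, snd l}) ls)) (perp x) =
      length (filter (vanishes x) ls)" for x
  proof (induction ls)
    case Nil
    then show ?case by (simp add: subspaces_in_def)
  next
    case (Cons l ls)
    then show ?case by (simp add: subspaces_in_def vanishes_iff_span)
  qed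
  ultimately show ?thesis
    using assms by (auto simp: bounded_system_iff_perp line_system_def)
qed

section \<open>Enlarging the members of a system to lines\<close>

definition independent_pair :: "('q::field ^ 'r) \<times> ('q ^ 'r) \<Rightarrow> bool" where
  "independent_pair l \<longleftrightarrow> fst l \<noteq> 0 \<and> snd l \<notin> vec.span {fst l}"

text \<open>A basis \<open>B\<close> of \<open>U\<close> is extended to a basis \<open>C\<close> of
  the whole space, and two vectors \<open>D\<close> with
  \<open>B \<subseteq> D \<subseteq> C\<close> span the line.\<close>

lemma subspace_in_line:
  fixes U :: "('q::field ^ 'r) set"
  assumes "2 \<le> CARD('r)" "vec.subspace U" "vec.dim U \<le> 2"
  obtains l :: "('q ^ 'r) \<times> ('q ^ 'r)" where "independent_pair l" "U \<subseteq> vec.span {fst l, snd l}"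
proof -
  obtain B where B: "B \<subseteq> U" "vec.independent B" "U \<subseteq> vec.span B" "card B = vec.dim U"
    using vec.basis_exists by metis
  obtain C where C: "B \<subseteq> C" "vec.independent C" "UNIV \<subseteq> vec.span C"
    using vec.maximal_independent_subset_extend[of B UNIV] B(2) by auto
  have "card C = CARD('r)"
    using vec.basis_card_eq_dim[OF subset_UNIV C(3,2)] vec_dim_card by (rule trans)
  then obtain D where D: "B \<subseteq> D" "D \<subseteq> C" "card D = 2"
    using exists_subset_between[of B 2 C] assms(1,3) B(4) C(1) vec.finiteI_independent[OF C(2)]
    by auto
  then obtain a b where ab: "D = {a, b}" "a \<noteq> b"
    by (meson card_2_iff)
  have "vec.independent {b, a}"
    using vec.independent_mono[OF C(2) D(2)] ab by (simp add: insert_commute)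
  then have "a \<noteq> 0" "b \<notin> vec.span {a}"
    using ab(2) by (auto simp: vec.independent_insert vec.dependent_zero vec.dependent_single split: if_splits)
  moreover have "U \<subseteq> vec.span {a, b}"
    using B(3) vec.span_mono[OF D(1)] ab by auto
  ultimately show thesis
    using that[of "(a, b)"] by (simp add: independent_pair_def)
qed

lemma lines_of_bounded_system:
  fixes M :: "('q::field ^ 'r) set multiset"
  assumes "2 \<le> CARD('r)" "bounded_system 2 s M"
  obtains ls :: "(('q ^ 'r) \<times> ('q ^ 'r)) list" where "length ls = size M" "line_system s ls" "\<forall>l\<in>set ls. independent_pair l"
proof -
  obtain Us where Us: "mset Us = M"
    using ex_mset by blast
  have U: "vec.subspace U \<and> vec.dim U \<le> 2" if "U \<in> set Us" for U
    using assms(2) that Us by (auto simp: bounded_system_def)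
  define line where "line U = (SOME l. independent_pair l \<and> U \<subseteq> vec.span {fst l, snd l})"
    for U :: "('q ^ 'r) set"
  have line: "independent_pair (line U) \<and> U \<subseteq> vec.span {fst (line U), snd (line U)}" if "U \<in> set Us" for U
    unfolding line_def
  proof (rule someI_ex)
    show "\<exists>l. independent_pair l \<and> U \<subseteq> vec.span {fst l, snd l}"
      using subspace_in_line[OF assms(1)] U[OF that] by blast
  qed
  have "line_system s (map line Us)"
    unfolding line_system_def
  proof (intro allI impI)
    fix x :: "'q ^ 'r"
    assume "x \<noteq> 0"
    have "length (filter (vanishes x) (map line Us)) = length (filter (\<lambda>U. vanishes x (line U)) Us)"
      by (simp add: filter_map comp_def)
    also have "\<dots> = size {#U \<in># M. vanishes x (line U)#}"
      by (simp flip: Us size_mset mset_filter)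
    also have "\<dots> \<le> subspaces_in M (perp x)"
      unfolding subspaces_in_def
    proof (rule size_mset_mono, rule filter_mset_mono_strong)
      show "U \<subseteq> perp x" if "U \<in># M" "vanishes x (line U)" for U
      proof -
        have "U \<in> set Us"
          using that(1) by (simp flip: Us)
        then show ?thesis
          using line[of U] that(2) by (auto simp: vanishes_iff_span)
      qed
    qed simp
    also have "\<dots> \<le> s"
      using assms(2) \<open>x \<noteq> 0\<close> by (simp add: bounded_system_iff_perp)
    finally show "length (filter (vanishes x) (map line Us)) \<le> s" .
  qed
  moreover have "\<forall>l\<in>set (map line Us). independent_pair l"
    using line by auto
  moreover have "length (map line Us) = size M"
    by (simp flip: Us)
  ultimately show thesis
    by (intro that)
qed

section \<open>The Griesmer bound\<close>

text \<open>The sum of \<open>d / q ^ i\<close>, rounded up, over \<open>i < k\<close>: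
  \<open>(d + (q - 1)) div q\<close> rounds \<open>d / q\<close> up, and rounding in stages agrees
  with rounding once.\<close>

fun griesmer :: "nat \<Rightarrow> nat \<Rightarrow> nat \<Rightarrow> nat" where
  "griesmer q 0 d = 0"
| "griesmer q (Suc k) d = d + griesmer q k ((d + (q - 1)) div q)"

lemma griesmer_mono: "d \<le> e \<Longrightarrow> griesmer q k d \<le> griesmer q k e"
proof (induction k arbitrary: d e)
  case (Suc k)
  have "(d + (q - 1)) div q \<le> (e + (q - 1)) div q"
    using Suc.prems by (intro div_le_mono) simp
  with Suc show ?case
    by (auto intro: add_mono)
qed simp

text \<open>Averaging over the coset \<open>c - b c\<^sub>0\<close>: each coordinate in the support of \<open>c\<^sub>0\<close>
  is killed by exactly one \<open>b\<close>.\<close>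

lemma sum_weight_pencil:
  fixes c c0 :: "'i \<Rightarrow> 'q::{field,finite}"
  assumes "finite I"
  shows "(\<Sum>b\<in>UNIV. card {i\<in>I. c i - b * c0 i \<noteq> 0}) =
    CARD('q) * card {i\<in>I. c0 i = 0 \<and> c i \<noteq> 0} + (CARD('q) - 1) * card {i\<in>I. c0 i \<noteq> 0}"
proof -
  have "(\<Sum>b\<in>UNIV. card {i\<in>I. c i - b * c0 i \<noteq> 0}) =
      (\<Sum>b\<in>UNIV. \<Sum>i\<in>I. if c i - b * c0 i \<noteq> 0 then 1 else 0)"
    using assms by (simp add: sum.If_cases Int_def)
  also have "\<dots> = (\<Sum>i\<in>I. \<Sum>b\<in>UNIV. if c i - b * c0 i \<noteq> 0 then 1 else 0)"
    by (rule sum.swap)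
  also have "\<dots> = (\<Sum>i\<in>I. card {b. c i - b * c0 i \<noteq> 0})"
    by (simp add: sum.If_cases)
  also have "\<dots> = (\<Sum>i\<in>I. (if c0 i = 0 \<and> c i \<noteq> 0 then CARD('q) else 0) +
      (if c0 i \<noteq> 0 then CARD('q) - 1 else 0))"
  proof (rule sum.cong)
    fix i
    show "card {b. c i - b * c0 i \<noteq> 0} =
        (if c0 i = 0 \<and> c i \<noteq> 0 then CARD('q) else 0) + (if c0 i \<noteq> 0 then CARD('q) - 1 else 0)"
    proof (cases "c0 i = 0")
      case False
      then have "{b. c i - b * c0 i \<noteq> 0} = UNIV - {c i / c0 i}"
        by (auto simp: field_simps)
      then show ?thesis
        using False by (simp add: card_Diff_subset)
    qed simp
  qed simp
  also have "\<dots> = CARD('q) * card {i\<in>I. c0 i = 0 \<and> c i \<noteq> 0} + (CARD('q) - 1) * card {i\<in>I. c0 i \<noteq> 0}"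
    using assms by (simp add: sum.distrib sum.If_cases Int_def)
  finally show ?thesis .
qed

text \<open>Residual code argument: restrict \<open>C\<close> to the zero positions \<open>J\<close>
  of a nonzero word \<open>c0\<close> of minimum weight. Only the multiples of \<open>c0\<close>
  become zero there, so the dimension drops by one, and every other word keeps weight at least
  \<open>wt c0 / q\<close>. Words are functions on the whole index type that vanish outside
  \<open>I\<close>, so the restricted code has the same type and the induction applies.\<close>

lemma griesmer_bound:
  fixes C :: "('i \<Rightarrow> 'q::{field,finite}) set"
  assumes "finite I" "card C = CARD('q) ^ k"
    and sub: "\<And>c e. c \<in> C \<Longrightarrow> e \<in> C \<Longrightarrow> (\<lambda>i. c i - e i) \<in> C"
    and scale: "\<And>c a. c \<in> C \<Longrightarrow> (\<lambda>i. a * c i) \<in> C"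
    and supp: "\<And>c i. c \<in> C \<Longrightarrow> i \<notin> I \<Longrightarrow> c i = 0"
    and dist: "\<And>c. c \<in> C \<Longrightarrow> c \<noteq> (\<lambda>_. 0) \<Longrightarrow> d \<le> card {i\<in>I. c i \<noteq> 0}"
  shows "griesmer CARD('q) k d \<le> card I"
  using assms
proof (induction k arbitrary: I C d)
  case 0
  then show ?case by simp
next
  case (Suc k)
  let ?q = "CARD('q)"
  note sub = Suc.prems(3) and scale = Suc.prems(4) and supp = Suc.prems(5) and dist = Suc.prems(6)
  have q: "2 \<le> ?q"
    using card_mono[of "UNIV :: 'q set" "{0, 1}"] by simp
  have finC: "finite C"
    by (rule card_ge_0_finite) (use Suc.prems(2) q in simp)
  define wt where "wt c = card {i\<in>I. c i \<noteq> 0}" for c :: "'i \<Rightarrow> 'q"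
  have "C - {\<lambda>_. 0} \<noteq> {}"
  proof
    assume "C - {\<lambda>_. 0} = {}"
    then have "card C \<le> card {\<lambda>_::'i. 0::'q}"
      by (intro card_mono) auto
    moreover have "?q \<le> card C"
      using Suc.prems(2) q by simp
    ultimately show False
      using q by simp
  qed
  then obtain c0 where "c0 \<in> C - {\<lambda>_. 0}" "\<And>c. c \<in> C - {\<lambda>_. 0} \<Longrightarrow> wt c0 \<le> wt c"
    using arg_min_least[of "C - {\<lambda>_. 0}" _ wt] arg_min_if_finite(1)[of "C - {\<lambda>_. 0}" wt] finC
    by (metis finite_Diff)
  then have c0: "c0 \<in> C" "c0 \<noteq> (\<lambda>_. 0)" and min: "\<And>c. c \<in> C \<Longrightarrow> c \<noteq> (\<lambda>_. 0) \<Longrightarrow> wt c0 \<le> wt c"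
    by auto
  define J where "J = {i\<in>I. c0 i = 0}"
  define res where "res c = (\<lambda>i. if i \<in> J then c i else 0)" for c :: "'i \<Rightarrow> 'q"
  have wt0: "0 < wt c0"
  proof -
    obtain i where "c0 i \<noteq> 0"
      using c0(2) by auto
    then have "i \<in> {i\<in>I. c0 i \<noteq> 0}"
      using supp[OF c0(1)] by auto
    then show ?thesis
      unfolding wt_def using Suc.prems(1) by (auto simp: card_gt_0_iff)
  qed
  \<comment> \<open>All \<open>q\<close> words \<open>c - b c0\<close> are nonzero, hence no lighter
    than \<open>c0\<close>; summing their weights over \<open>b\<close> bounds the weight of
    \<open>c\<close> on \<open>J\<close> from below.\<close>
  have key: "wt c0 \<le> ?q * card {i\<in>J. c i \<noteq> 0}" if c: "c \<in> C" "\<And>b. c \<noteq> (\<lambda>i. b * c0 i)" for c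
  proof -
    have "wt c0 \<le> card {i\<in>I. c i - b * c0 i \<noteq> 0}" for b
      using min[OF sub[OF c(1) scale[OF c0(1)]], of b] c(2)[of b] by (auto simp: wt_def fun_eq_iff)
    then have "?q * wt c0 \<le> (\<Sum>b\<in>UNIV. card {i\<in>I. c i - b * c0 i \<noteq> 0})"
      using sum_mono[of UNIV "\<lambda>_. wt c0" "\<lambda>b. card {i\<in>I. c i - b * c0 i \<noteq> 0}"] by simp
    also have "\<dots> = ?q * card {i\<in>J. c i \<noteq> 0} + (?q - 1) * wt c0"
      unfolding sum_weight_pencil[OF Suc.prems(1)] by (simp add: J_def wt_def)
    finally have "?q * wt c0 \<le> ?q * card {i\<in>J. c i \<noteq> 0} + (?q - 1) * wt c0" .
    moreover have "?q * wt c0 = wt c0 + (?q - 1) * wt c0"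
      using q by (metis Suc_diff_1 mult_Suc zero_less_card_finite)
    ultimately show ?thesis
      by linarith
  qed
  have res_eq: "{e \<in> C. res e = res c} = (\<lambda>b i. c i - b * c0 i) ` UNIV" if c: "c \<in> C" for c
  proof safe
    fix e
    assume e: "e \<in> C" "res e = res c"
    have "{i\<in>J. c i - e i \<noteq> 0} = {}"
      using e(2) by (auto simp: res_def fun_eq_iff split: if_splits)
    \<comment> \<open>The word \<open>c - e\<close> is zero on \<open>J\<close>, which
      \<open>key\<close> allows only for a multiple of \<open>c0\<close>.\<close>
    then have "\<not> wt c0 \<le> ?q * card {i\<in>J. c i - e i \<noteq> 0}"
      using wt0 by (simp only: card.empty)
    then obtain b where "(\<lambda>i. c i - e i) = (\<lambda>i. b * c0 i)"
      using key[OF sub[OF c e(1)]] by blast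
    then have "e = (\<lambda>i. c i - b * c0 i)"
      by (auto simp: fun_eq_iff algebra_simps)
    then show "e \<in> range (\<lambda>b i. c i - b * c0 i)"
      by blast
  next
    fix b
    show "(\<lambda>i. c i - b * c0 i) \<in> C"
      by (rule sub[OF c scale[OF c0(1)]])
    show "res (\<lambda>i. c i - b * c0 i) = res c"
      by (auto simp: res_def J_def)
  qed
  have fiber: "card {e \<in> C. res e = y} = ?q" if y: "y \<in> res ` C" for y
  proof -
    obtain c where c: "c \<in> C" "y = res c"
      using y by blast
    obtain i where "c0 i \<noteq> 0"
      using c0(2) by auto
    then have "inj (\<lambda>b i. c i - b * c0 i)"
      by (auto intro!: injI simp: fun_eq_iff)
    then show ?thesis
      unfolding c(2) res_eq[OF c(1)] by (rule card_image)
  qed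
  have "card C = (\<Sum>y\<in>res ` C. card {e \<in> C. res e = y})"
    using sum.image_gen[OF finC, of "\<lambda>_. 1::nat" res] by simp
  also have "\<dots> = card (res ` C) * ?q"
    using fiber by simp
  finally have cardC': "card (res ` C) = ?q ^ k"
    using Suc.prems(2) q by simp
  have "griesmer ?q k ((wt c0 + (?q - 1)) div ?q) \<le> card J"
  proof (rule Suc.IH[OF _ cardC'])
    show "finite J"
      using Suc.prems(1) by (simp add: J_def)
    show "(\<lambda>i. c i - e i) \<in> res ` C" if "c \<in> res ` C" "e \<in> res ` C" for c e
    proof -
      obtain c' e' where ce: "c' \<in> C" "c = res c'" "e' \<in> C" "e = res e'"
        using \<open>c \<in> res ` C\<close> \<open>e \<in> res ` C\<close> by blast
      then have "(\<lambda>i. c i - e i) = res (\<lambda>i. c' i - e' i)"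
        by (auto simp: res_def)
      then show ?thesis
        using sub ce by blast
    qed
    show "(\<lambda>i. a * c i) \<in> res ` C" if c: "c \<in> res ` C" for c a
    proof -
      obtain c' where ce: "c' \<in> C" "c = res c'"
        using c by blast
      then have "(\<lambda>i. a * c i) = res (\<lambda>i. a * c' i)"
        by (auto simp: res_def)
      then show ?thesis
        using scale ce by blast
    qed
    show "c i = 0" if "c \<in> res ` C" "i \<notin> J" for c i
      using that by (auto simp: res_def)
    show "(wt c0 + (?q - 1)) div ?q \<le> card {i\<in>J. c i \<noteq> 0}" if c: "c \<in> res ` C" "c \<noteq> (\<lambda>_. 0)" for c
    proof -
      obtain c' where c': "c' \<in> C" "c = res c'"
        using c(1) by blast
      have "c' \<noteq> (\<lambda>i. b * c0 i)" for b
      proof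
        assume "c' = (\<lambda>i. b * c0 i)"
        then have "c = (\<lambda>_. 0)"
          by (auto simp: c'(2) res_def J_def)
        with c(2) show False
          by simp
      qed
      then have "wt c0 \<le> ?q * card {i\<in>J. c' i \<noteq> 0}"
        by (rule key[OF c'(1)])
      also have "{i\<in>J. c' i \<noteq> 0} = {i\<in>J. c i \<noteq> 0}"
        by (auto simp: c'(2) res_def)
      finally have "wt c0 + (?q - 1) \<le> ?q * card {i\<in>J. c i \<noteq> 0} + (?q - 1)"
        by simp
      then have "(wt c0 + (?q - 1)) div ?q \<le> (?q * card {i\<in>J. c i \<noteq> 0} + (?q - 1)) div ?q"
        by (rule div_le_mono)
      also have "\<dots> = card {i\<in>J. c i \<noteq> 0}"
        using q by (subst div_mult_self4) simp_all
      finally show ?thesis .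
    qed
  qed
  moreover have "card I = card J + wt c0"
  proof -
    have "I = J \<union> {i\<in>I. c0 i \<noteq> 0}"
      by (auto simp: J_def)
    moreover have "card (J \<union> {i\<in>I. c0 i \<noteq> 0}) = card J + wt c0"
      unfolding wt_def using Suc.prems(1) by (intro card_Un_disjoint) (auto simp: J_def)
    ultimately show ?thesis by simp
  qed
  \<comment> \<open>The induction gave the bound for the true minimum weight \<open>wt c0\<close>,
    which may exceed \<open>d\<close>.\<close>
  moreover have "griesmer ?q (Suc k) d \<le> griesmer ?q (Suc k) (wt c0)"
    using dist[OF c0] by (intro griesmer_mono) (simp add: wt_def)
  ultimately show ?case
    by simp
qed

text \<open>The coordinates of the code are indexed by the points of the lines: \<open>(j, Some b)\<close> stands for
  the point \<open>fst l + b \<cdot> snd l\<close> and \<open>(j, None)\<close> for the point \<open>snd l\<close> of the \<open>j\<close>-th line \<open>l\<close>.\<close>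

definition code_word :: "(('q::field ^ 'r) \<times> ('q ^ 'r)) list \<Rightarrow> 'q ^ 'r \<Rightarrow> nat \<times> 'q option \<Rightarrow> 'q" where
  "code_word ls x = (\<lambda>(j, p).
     if j < length ls then
       (case p of None \<Rightarrow> dotp x (snd (ls ! j)) | Some b \<Rightarrow> dotp x (fst (ls ! j)) + b * dotp x (snd (ls ! j)))
     else 0)"

text \<open>A functional that is not zero on the whole line has exactly one zero among its points:
  \<open>None\<close> if \<open>v = 0\<close>, otherwise \<open>Some (- u / v)\<close>.\<close>

lemma card_nonzero_points_of_line:
  fixes u v :: "'q::{field,finite}"
  shows "card {p. (case p of None \<Rightarrow> v | Some b \<Rightarrow> u + b * v) \<noteq> 0} = (if u = 0 \<and> v = 0 then 0 else CARD('q))"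
    (is "card ?P = _")
proof -
  have split: "?P = (if v \<noteq> 0 then {None} else {}) \<union> Some ` {b. u + b * v \<noteq> 0}"
  proof (rule set_eqI)
    fix p
    show "p \<in> ?P \<longleftrightarrow> p \<in> (if v \<noteq> 0 then {None} else {}) \<union> Some ` {b. u + b * v \<noteq> 0}"
      by (cases p) auto
  qed
  have "card ?P = (if v \<noteq> 0 then 1 else 0) + card {b. u + b * v \<noteq> 0}"
    unfolding split by (subst card_Un_disjoint) (auto simp: card_image)
  moreover have "card {b. u + b * v \<noteq> 0} = CARD('q) - 1" if "v \<noteq> 0"
  proof -
    have "u + b * v = 0 \<longleftrightarrow> b = - u / v" for b
    proof -
      have "u + b * v = 0 \<longleftrightarrow> b * v = - u"
        by (simp add: eq_neg_iff_add_eq_0 add.commute)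
      also have "\<dots> \<longleftrightarrow> b = - u / v"
        using that by (rule nonzero_eq_divide_eq[symmetric])
      finally show ?thesis .
    qed
    then have "{b. u + b * v \<noteq> 0} = UNIV - {- u / v}"
      by auto
    then show ?thesis
      by (simp add: card_Diff_subset)
  qed
  ultimately show ?thesis
    by auto
qed

lemma weight_code_word:
  fixes ls :: "(('q::{field,finite} ^ 'r) \<times> ('q ^ 'r)) list"
  shows "card {i \<in> {..<length ls} \<times> UNIV. code_word ls x i \<noteq> 0} =
    CARD('q) * (length ls - length (filter (vanishes x) ls))"
proof -
  let ?P = "\<lambda>j. {p. (case p of None \<Rightarrow> dotp x (snd (ls ! j))
    | Some b \<Rightarrow> dotp x (fst (ls ! j)) + b * dotp x (snd (ls ! j))) \<noteq> 0}"
  have "{i \<in> {..<length ls} \<times> UNIV. code_word ls x i \<noteq> 0} = Sigma {..<length ls} ?P"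
    by (auto simp: code_word_def)
  then have "card {i \<in> {..<length ls} \<times> UNIV. code_word ls x i \<noteq> 0} = (\<Sum>j<length ls. card (?P j))"
    by (simp add: card_SigmaI)
  also have "\<dots> = (\<Sum>j<length ls. if \<not> vanishes x (ls ! j) then CARD('q) else 0)"
    unfolding card_nonzero_points_of_line vanishes_def by (intro sum.cong) auto
  also have "\<dots> = CARD('q) * card {j. j < length ls \<and> \<not> vanishes x (ls ! j)}"
    by (simp add: sum.If_cases Int_def)
  also have "card {j. j < length ls \<and> \<not> vanishes x (ls ! j)} = length ls - length (filter (vanishes x) ls)"
    using length_filter_conv_card[of "\<lambda>l. \<not> vanishes x l" ls] sum_length_filter_compl[of "vanishes x" ls]
    by simp
  finally show ?thesis .
qed

text \<open>If \<open>s < length ls\<close>, every nonzero functional has positive weight, so the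
  code has one word for each functional and thus full dimension. Otherwise the truncated difference
  is 0, and so is the Griesmer sum.\<close>

lemma griesmer_line_system:
  fixes ls :: "(('q::{field,finite} ^ 'r) \<times> ('q ^ 'r)) list"
  assumes "line_system s ls"
  shows "griesmer CARD('q) CARD('r) (CARD('q) * (length ls - s)) \<le> length ls * (CARD('q) + 1)"
proof (cases "s < length ls")
  case False
  have "griesmer q k 0 = 0" if "0 < q" for q k
    using that by (induction k) auto
  with False show ?thesis
    by simp
next
  case True
  let ?q = "CARD('q)" and ?I = "{..<length ls} \<times> (UNIV :: 'q option set)"
  have dist: "?q * (length ls - s) \<le> card {i \<in> ?I. code_word ls x i \<noteq> 0}" if "x \<noteq> 0" for x
    unfolding weight_code_word using assms that by (intro mult_le_mono2 diff_le_mono2) (auto simp: line_system_def)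
  have diff: "code_word ls (x - y) = (\<lambda>i. code_word ls x i - code_word ls y i)" for x y
    by (auto simp: code_word_def fun_eq_iff algebra_simps split: option.splits)
  have nz: "code_word ls x \<noteq> (\<lambda>_. 0)" if "x \<noteq> 0" for x
  proof
    assume "code_word ls x = (\<lambda>_. 0)"
    then have "?q * (length ls - s) \<le> 0"
      using dist[OF that] by simp
    then show False
      using True by simp
  qed
  have "inj (code_word ls)"
  proof (rule injI)
    fix x y
    assume "code_word ls x = code_word ls y"
    then have "code_word ls (x - y) = (\<lambda>_. 0)"
      by (simp add: diff)
    then show "x = y"
      using nz[of "x - y"] by auto
  qed
  then have "card (range (code_word ls)) = ?q ^ CARD('r)"
    by (simp add: card_image)
  then have "griesmer ?q CARD('r) (?q * (length ls - s)) \<le> card ?I"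
  proof (rule griesmer_bound[rotated])
    show "(\<lambda>i. c i - e i) \<in> range (code_word ls)" if ce: "c \<in> range (code_word ls)" "e \<in> range (code_word ls)" for c e
    proof -
      obtain x y where "c = code_word ls x" "e = code_word ls y"
        using ce by blast
      then have "(\<lambda>i. c i - e i) = code_word ls (x - y)"
        by (simp add: diff)
      then show ?thesis
        by blast
    qed
    show "(\<lambda>i. a * c i) \<in> range (code_word ls)" if c: "c \<in> range (code_word ls)" for c a
    proof -
      obtain x where "c = code_word ls x"
        using c by blast
      then have "(\<lambda>i. a * c i) = code_word ls (a *s x)"
        by (auto simp: code_word_def fun_eq_iff algebra_simps split: option.splits)
      then show ?thesis
        by blast
    qed
    show "c i = 0" if "c \<in> range (code_word ls)" "i \<notin> ?I" for c i
      using that by (cases i) (auto simp: code_word_def)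
    show "?q * (length ls - s) \<le> card {i \<in> ?I. c i \<noteq> 0}" if c: "c \<in> range (code_word ls)" "c \<noteq> (\<lambda>_. 0)" for c
    proof -
      obtain x where x: "c = code_word ls x"
        using c(1) by blast
      have "code_word ls 0 = (\<lambda>_. 0)"
        using diff[of 0 0] by simp
      then have "x \<noteq> 0"
        using c(2) x by auto
      then show ?thesis
        unfolding x by (rule dist)
    qed
  qed simp
  then show ?thesis
    by (simp add: card_cartesian_product card_UNIV_option)
qed

text \<open>The numbers \<open>c1\<close>, \<open>c2\<close>, \<open>c3\<close> are the last three
  Griesmer terms for the distance \<open>4 * (length ls - s)\<close>. Only inequalities between them
  are kept, so that the later bounds become linear arithmetic.\<close>

lemma length_line_system_griesmer:
  fixes ls :: "(('q::{field,finite} ^ 'r) \<times> ('q ^ 'r)) list"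
  assumes "CARD('q) = 4" "CARD('r) = 5" "line_system s ls"
  obtains c1 c2 c3 where "length ls \<le> s + 4 * c1" "c1 \<le> 4 * c2" "c2 \<le> 4 * c3" "c1 + c2 + c3 \<le> 5 * s"
proof -
  define d where "d = length ls - s"
  have 4: "(4 * d + 3) div 4 = d"
    by simp
  define c1 where "c1 = (d + 3) div 4"
  define c2 where "c2 = (c1 + 3) div 4"
  define c3 where "c3 = (c2 + 3) div 4"
  have 5: "5 = Suc (Suc (Suc (Suc (Suc 0))))"
    by simp
  have "griesmer 4 (Suc (Suc (Suc (Suc (Suc 0))))) (4 * d) = 4 * d + (d + (c1 + (c2 + c3)))"
    by (simp add: 4 c1_def c2_def c3_def)
  then have "griesmer 4 5 (4 * d) = 4 * d + (d + (c1 + (c2 + c3)))"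
    by (simp only: 5)
  then have "5 * d + c1 + c2 + c3 \<le> 5 * length ls"
    using griesmer_line_system[OF assms(3)] by (simp add: assms(1,2) d_def)
  moreover have "m \<le> 4 * ((m + 3) div 4)" for m :: nat
    by presburger
  then have "d \<le> 4 * c1" "c1 \<le> 4 * c2" "c2 \<le> 4 * c3"
    by (simp_all add: c1_def c2_def c3_def)
  moreover have "length ls \<le> s \<Longrightarrow> c1 + c2 + c3 = 0"
    by (simp add: c1_def c2_def c3_def d_def)
  ultimately show thesis
    using that[of c1 c2 c3] unfolding d_def by linarith
qed

section \<open>Systems with few lines in each hyperplane\<close>

text \<open>Here \<open>S\<close> is a space of functionals and \<open>v\<close> the vector at which
  they are evaluated. Every fibre of this evaluation is a translate of the zero fibre by a multiple
  of \<open>x0\<close>.\<close>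

lemma card_subspace_perp:
  fixes S :: "('q::{field,finite} ^ 'r) set"
  assumes S: "vec.subspace S" and x0: "x0 \<in> S" "dotp x0 v \<noteq> 0"
  shows "CARD('q) * card {x \<in> S. dotp x v = 0} = card S"
proof -
  have fiber: "card {x \<in> S. dotp x v = b} = card {x \<in> S. dotp x v = 0}" for b
  proof -
    define u where "u = (b / dotp x0 v) *s x0"
    have u: "u \<in> S" "dotp u v = b"
      using x0 S by (simp_all add: u_def vec.subspace_scale)
    have "{x \<in> S. dotp x v = b} = (\<lambda>x. x + u) ` {x \<in> S. dotp x v = 0}"
    proof (intro set_eqI iffI)
      fix x
      assume "x \<in> {x \<in> S. dotp x v = b}"
      then have "x - u \<in> {x \<in> S. dotp x v = 0}" "x = (x - u) + u"
        using u S by (auto simp: vec.subspace_diff)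
      then show "x \<in> (\<lambda>x. x + u) ` {x \<in> S. dotp x v = 0}"
        by blast
    qed (use u S in \<open>auto simp: vec.subspace_add\<close>)
    then show ?thesis
      by (simp add: card_image)
  qed
  have "card S = (\<Sum>b\<in>UNIV. card {x \<in> S. dotp x v = b})"
    using sum.group[of S UNIV "\<lambda>x. dotp x v" "\<lambda>_. 1::nat"] by simp
  also have "\<dots> = (\<Sum>b\<in>(UNIV :: 'q set). card {x \<in> S. dotp x v = 0})"
    by (rule sum.cong[OF refl fiber])
  finally show ?thesis
    by simp
qed

lemma card_subspace_perp_ge:
  fixes S :: "('q::{field,finite} ^ 'r) set"
  assumes "vec.subspace S"
  shows "card S \<le> CARD('q) * card {x \<in> S. dotp x v = 0}"
proof (cases "\<exists>x\<in>S. dotp x v \<noteq> 0")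
  case True
  then show ?thesis
    using card_subspace_perp[OF assms] by force
next
  case False
  then have "{x \<in> S. dotp x v = 0} = S"
    by auto
  then show ?thesis
    by simp
qed

lemma subspace_dotp_eq_0:
  assumes "vec.subspace S"
  shows "vec.subspace {x \<in> S. dotp x v = 0}"
  by (rule vec.subspaceI) (use assms in \<open>auto simp: vec.subspace_0 vec.subspace_add vec.subspace_scale\<close>)

lemma subspace_vanishes: "vec.subspace {x. vanishes x l}"
  by (rule vec.subspaceI) (auto simp: vanishes_def)

lemma card_vanishes:
  fixes l :: "('q::{field,finite} ^ 'r) \<times> ('q ^ 'r)"
  assumes "independent_pair l"
  shows "CARD('q) * (CARD('q) * card {x. vanishes x l}) = CARD('q) ^ CARD('r)"
proof -
  have a: "fst l \<notin> {0}" and b: "snd l \<notin> vec.span {fst l}"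
    using assms by (auto simp: independent_pair_def)
  obtain x where "dotp x (fst l) = 1"
    using separating_functional[OF vec.subspace_single_0 a] by metis
  then have 1: "CARD('q) * card {x \<in> UNIV. dotp x (fst l) = 0} = card (UNIV :: ('q ^ 'r) set)"
    by (intro card_subspace_perp[where ?x0.0 = x]) auto
  obtain y where y: "vec.span {fst l} \<subseteq> perp y" "dotp y (snd l) = 1"
    using separating_functional[OF vec.subspace_span b] by metis
  have "fst l \<in> vec.span {fst l}"
    by (simp add: vec.span_base)
  with y(1) have "dotp y (fst l) = 0"
    by (auto simp: perp_def)
  then have "CARD('q) * card {x \<in> {x \<in> UNIV. dotp x (fst l) = 0}. dotp x (snd l) = 0} =
      card {x \<in> UNIV. dotp x (fst l) = 0}"
    using y(2) by (intro card_subspace_perp[where ?x0.0 = y] subspace_dotp_eq_0) auto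
  with 1 show ?thesis
    by (simp add: vanishes_def)
qed

lemma card_vanishes_off_line:
  fixes l :: "('q::{field,finite} ^ 'r) \<times> ('q ^ 'r)"
  assumes "v \<notin> vec.span {fst l, snd l}"
  shows "CARD('q) * card {x. vanishes x l \<and> dotp x v = 0} = card {x. vanishes x l}"
proof -
  obtain y where y: "vec.span {fst l, snd l} \<subseteq> perp y" "dotp y v = 1"
    using separating_functional[OF vec.subspace_span assms] by metis
  then show ?thesis
    using card_subspace_perp[OF subspace_vanishes, of y l v] by (simp add: vanishes_iff_span)
qed

lemma card_vanishes_two:
  fixes l m :: "('q::{field,finite} ^ 'r) \<times> ('q ^ 'r)"
  shows "card {x. vanishes x l} \<le> CARD('q) * (CARD('q) * card {x. vanishes x l \<and> vanishes x m})"
proof -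
  have "card {x. vanishes x l} \<le> CARD('q) * card {x \<in> {x. vanishes x l}. dotp x (fst m) = 0}"
    by (rule card_subspace_perp_ge[OF subspace_vanishes])
  also have "\<dots> \<le> CARD('q) * (CARD('q) *
      card {x \<in> {x \<in> {x. vanishes x l}. dotp x (fst m) = 0}. dotp x (snd m) = 0})"
    by (intro mult_le_mono2 card_subspace_perp_ge subspace_dotp_eq_0 subspace_vanishes)
  also have "{x \<in> {x \<in> {x. vanishes x l}. dotp x (fst m) = 0}. dotp x (snd m) = 0} =
      {x. vanishes x l \<and> vanishes x m}"
    by (auto simp: vanishes_def)
  finally show ?thesis .
qed

section \<open>Double counting over the hyperplanes through a line\<close>

lemma sum_length_filter:
  assumes "finite X"
  shows "(\<Sum>x\<in>X. length (filter (P x) ls)) = (\<Sum>l\<leftarrow>ls. card {x\<in>X. P x l})"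
proof (induction ls)
  case (Cons l ls)
  have "(\<Sum>x\<in>X. length (filter (P x) (l # ls))) =
      (\<Sum>x\<in>X. (if P x l then 1 else 0) + length (filter (P x) ls))"
    by (rule sum.cong) auto
  also have "\<dots> = card {x\<in>X. P x l} + (\<Sum>x\<in>X. length (filter (P x) ls))"
    using assms by (simp add: sum.distrib sum.If_cases Int_def)
  finally show ?case
    using Cons by simp
qed simp

lemma card_minus_zero:
  fixes S :: "('q::{field,finite} ^ 'r) set"
  assumes "0 \<in> S"
  shows "card {x \<in> S. x \<noteq> 0} = card S - 1"
proof -
  have "{x \<in> S. x \<noteq> 0} = S - {0}"
    by auto
  then show ?thesis
    using assms by simp
qed

text \<open>Each hyperplane through \<open>l\<close> is given by three functionals, so 63 stands for
  21 hyperplanes. Two lines span at most dimension 4 and hence share a hyperplane, so every other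
  line contributes at least 3 to the sum, while \<open>l\<close> contributes 63 = 3 + 60.\<close>

lemma hyperplanes_through_line:
  fixes ls :: "(('q::{field,finite} ^ 'r) \<times> ('q ^ 'r)) list"
  assumes "CARD('q) = 4" "CARD('r) = 5" "\<forall>m\<in>set ls. independent_pair m" "l \<in> set ls"
  shows "card {x. x \<noteq> 0 \<and> vanishes x l} = 63"
    and "3 * length ls + 60 \<le> (\<Sum>x\<in>{x. x \<noteq> 0 \<and> vanishes x l}. length (filter (vanishes x) ls))"
proof -
  let ?X = "{x. x \<noteq> 0 \<and> vanishes x l}"
  have 64: "card {x. vanishes x l} = 64"
    using card_vanishes[of l] assms by simp
  have X: "?X = {x \<in> {x. vanishes x l}. x \<noteq> 0}"
    by auto
  show 63: "card ?X = 63"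
    unfolding X by (subst card_minus_zero) (simp_all add: 64, simp add: vanishes_def)
  \<comment> \<open>\<open>card_vanishes_two\<close> gives at least 64 / 16 = 4 functionals, one of
    which is zero.\<close>
  have 3: "3 \<le> card {x \<in> ?X. vanishes x m}" for m
  proof -
    have "{x \<in> ?X. vanishes x m} = {x \<in> {x. vanishes x l \<and> vanishes x m}. x \<noteq> 0}"
      by auto
    then have "card {x \<in> ?X. vanishes x m} = card {x. vanishes x l \<and> vanishes x m} - 1"
      by (subst card_minus_zero[symmetric]) (auto simp: vanishes_def)
    then show ?thesis
      using card_vanishes_two[of l m] by (simp add: 64 assms(1))
  qed
  obtain as bs where ls: "ls = as @ l # bs"
    using assms(4) split_list by metis
  have ge: "3 * length ms \<le> (\<Sum>m\<leftarrow>ms. card {x \<in> ?X. vanishes x m})" for ms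
    using 3 by (induction ms) (auto intro: add_mono)
  have "{x \<in> ?X. vanishes x l} = ?X"
    by auto
  then have "(\<Sum>m\<leftarrow>ls. card {x \<in> ?X. vanishes x m}) =
      (\<Sum>m\<leftarrow>as. card {x \<in> ?X. vanishes x m}) + 63 + (\<Sum>m\<leftarrow>bs. card {x \<in> ?X. vanishes x m})"
    by (simp only: ls map_append list.map sum_list_append sum_list.Cons 63 add.assoc)
  moreover have "(\<Sum>x\<in>?X. length (filter (vanishes x) ls)) = (\<Sum>m\<leftarrow>ls. card {x \<in> ?X. vanishes x m})"
    by (rule sum_length_filter) simp
  moreover have "length ls = length as + length bs + 1"
    by (simp add: ls)
  ultimately show "3 * length ls + 60 \<le> (\<Sum>x\<in>?X. length (filter (vanishes x) ls))"
    using ge[of as] ge[of bs] by linarith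
qed

lemma length_line_system_le_21:
  fixes ls :: "(('q::{field,finite} ^ 'r) \<times> ('q ^ 'r)) list"
  assumes "CARD('q) = 4" "CARD('r) = 5" "\<forall>m\<in>set ls. independent_pair m" "line_system s ls" "ls \<noteq> []"
  shows "length ls + 20 \<le> 21 * s"
proof -
  obtain l where l: "l \<in> set ls"
    using assms(5) by (cases ls) auto
  let ?X = "{x. x \<noteq> 0 \<and> vanishes x l}"
  have "(\<Sum>x\<in>?X. length (filter (vanishes x) ls)) \<le> (\<Sum>x\<in>?X. s)"
    using assms(4) by (intro sum_mono) (auto simp: line_system_def)
  with hyperplanes_through_line[OF assms(1-3) l] show ?thesis
    by simp
qed

text \<open>The nonzero scalars act freely on \<open>Z\<close>, which is therefore a disjoint union
  of orbits of size \<open>q - 1\<close>.\<close>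

lemma dvd_card_scalar_closed:
  fixes Z :: "('q::{field,finite} ^ 'r) set"
  assumes "0 \<notin> Z" "\<And>a x. a \<noteq> 0 \<Longrightarrow> x \<in> Z \<Longrightarrow> a *s x \<in> Z"
  shows "CARD('q) - 1 dvd card Z"
proof -
  define orb where "orb x = (\<lambda>a. a *s x) ` (UNIV - {0 :: 'q})" for x :: "'q ^ 'r"
  have card: "card (orb x) = CARD('q) - 1" if "x \<in> Z" for x
  proof -
    have "x \<noteq> 0"
      using that assms(1) by auto
    then have "inj_on (\<lambda>a. a *s x) (UNIV - {0})"
      by (auto intro!: inj_onI)
    then show ?thesis
      by (simp add: orb_def card_image card_Diff_subset)
  qed
  have orb_eq: "orb x = orb y" if z: "z \<in> orb x" "z \<in> orb y" for x y z
  proof -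
    obtain a where a: "a \<noteq> 0" "z = a *s x"
      using z(1) by (auto simp: orb_def)
    obtain b where b: "b \<noteq> 0" "z = b *s y"
      using z(2) by (auto simp: orb_def)
    have sub: "orb (c *s u) = orb u" if "c \<noteq> 0" for c and u :: "'q ^ 'r"
    proof (intro set_eqI iffI)
      fix w
      assume "w \<in> orb (c *s u)"
      then show "w \<in> orb u"
        using that by (auto simp: orb_def image_iff vec.scale_scale intro!: bexI[of _ "_ * c"])
    next
      fix w
      assume "w \<in> orb u"
      then obtain d where "d \<noteq> 0" "w = d *s u"
        by (auto simp: orb_def)
      then have "w = (d / c) *s (c *s u)" "d / c \<noteq> 0"
        using that by auto
      then show "w \<in> orb (c *s u)"
        unfolding orb_def by blast
    qed
    show ?thesis
      using sub[OF a(1), of x] sub[OF b(1), of y] a(2) b(2) by metis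
  qed
  have union: "\<Union>(orb ` Z) = Z"
  proof
    show "\<Union>(orb ` Z) \<subseteq> Z"
      using assms(2) by (auto simp: orb_def)
    have "x \<in> orb x" for x
      unfolding orb_def by (rule image_eqI[of _ _ 1]) auto
    then show "Z \<subseteq> \<Union>(orb ` Z)"
      by blast
  qed
  have "(CARD('q) - 1) * card (orb ` Z) = card (\<Union>(orb ` Z))"
  proof (rule card_partition)
    show "card c = CARD('q) - 1" if "c \<in> orb ` Z" for c
      using that card by auto
    show "c1 \<inter> c2 = {}" if "c1 \<in> orb ` Z" "c2 \<in> orb ` Z" "c1 \<noteq> c2" for c1 c2
      using that orb_eq by blast
  qed simp_all
  then show ?thesis
    unfolding union by (metis dvd_triv_left)
qed

text \<open>If equality held in the previous bound for \<open>s = 3\<close>, every hyperplane would contain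
  none or three of the lines. The three-line hyperplanes through a point off all lines would then
  number \<open>43 \<cdot> 5 / 3\<close>.\<close>

lemma length_line_system_3:
  fixes ls :: "(('q::{field,finite} ^ 'r) \<times> ('q ^ 'r)) list"
  assumes q: "CARD('q) = 4" and r: "CARD('r) = 5"
    and ind: "\<forall>m\<in>set ls. independent_pair m" and ls: "line_system 3 ls"
  shows "length ls \<le> 42"
proof (rule ccontr)
  assume "\<not> ?thesis"
  then have ne: "ls \<noteq> []" and "43 \<le> length ls"
    by auto
  then have len: "length ls = 43"
    using length_line_system_le_21[OF q r ind ls] by simp
  define N where "N x = length (filter (vanishes x) ls)" for x
  have N_le: "N x \<le> 3" if "x \<noteq> 0" for x
    using ls that by (auto simp: N_def line_system_def)
  \<comment> \<open>With 43 lines the sum over the 63 functionals is at least 3 * 43 + 60 = 3 * 63,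
    so not a single count can be below 3.\<close>
  have N3: "N x = 3" if l: "l \<in> set ls" and x: "x \<noteq> 0" "vanishes x l" for l x
  proof (rule ccontr)
    let ?X = "{x. x \<noteq> 0 \<and> vanishes x l}"
    assume "N x \<noteq> 3"
    then have "N x < 3"
      using N_le[OF x(1)] by simp
    then have "(\<Sum>x\<in>?X. N x) < (\<Sum>x\<in>?X. 3)"
      using x N_le by (intro sum_strict_mono_ex1) auto
    then show False
      using hyperplanes_through_line[OF q r ind l] by (simp add: N_def len)
  qed
  have span: "card (vec.span {a, b}) \<le> 16" for a b :: "'q ^ 'r"
  proof -
    have "vec.span {a, b} \<subseteq> (\<lambda>(s, t). s *s a + t *s b) ` UNIV"
    proof
      fix y
      assume "y \<in> vec.span {a, b}"
      then obtain s where "y - s *s a \<in> vec.span {b}"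
        by (auto simp: vec.span_insert)
      then obtain t where "y - s *s a = t *s b"
        by (auto simp: vec.span_singleton)
      then have "y = s *s a + t *s b"
        by (simp add: algebra_simps)
      then show "y \<in> (\<lambda>(s, t). s *s a + t *s b) ` UNIV"
        by auto
    qed
    then have "card (vec.span {a, b}) \<le> card (UNIV :: ('q \<times> 'q) set)"
      by (rule surj_card_le[rotated]) simp
    then show ?thesis
      by (simp add: q)
  qed
  \<comment> \<open>The lines cover at most 43 * 16 = 688 of the 1024 vectors, so some vector
    \<open>v\<close> lies off all of them.\<close>
  have "card (\<Union>l\<in>set ls. vec.span {fst l, snd l}) \<le> (\<Sum>l\<in>set ls. card (vec.span {fst l, snd l}))"
    by (rule card_UN_le) simp
  also have "\<dots> \<le> card (set ls) * 16"
    using sum_bounded_above[of "set ls" "\<lambda>l. card (vec.span {fst l, snd l})" 16] span by simp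
  also have "\<dots> \<le> 43 * 16"
    using card_length[of ls] len by simp
  also have "\<dots> < card (UNIV :: ('q ^ 'r) set)"
    by (simp add: q r)
  finally have less: "card (\<Union>l\<in>set ls. vec.span {fst l, snd l}) < card (UNIV :: ('q ^ 'r) set)" .
  have "(\<Union>l\<in>set ls. vec.span {fst l, snd l}) \<noteq> UNIV"
  proof
    assume "(\<Union>l\<in>set ls. vec.span {fst l, snd l}) = UNIV"
    with less show False
      by simp
  qed
  then obtain v where v: "v \<notin> (\<Union>l\<in>set ls. vec.span {fst l, snd l})"
    by blast
  define Y where "Y = {x. x \<noteq> 0 \<and> dotp x v = 0}"
  \<comment> \<open>Of the 64 functionals that vanish on \<open>l\<close>, a quarter also vanish at
    \<open>v\<close>; dropping zero leaves 15.\<close>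
  have "card {x \<in> Y. vanishes x l} = 15" if l: "l \<in> set ls" for l
  proof -
    have "{x \<in> Y. vanishes x l} = {x \<in> {x. vanishes x l \<and> dotp x v = 0}. x \<noteq> 0}"
      by (auto simp: Y_def)
    then have "card {x \<in> Y. vanishes x l} = card {x. vanishes x l \<and> dotp x v = 0} - 1"
      by (subst card_minus_zero[symmetric]) (auto simp: vanishes_def)
    moreover have "4 * card {x. vanishes x l \<and> dotp x v = 0} = card {x. vanishes x l}"
      using card_vanishes_off_line[of v l] v l q by auto
    moreover have "card {x. vanishes x l} = 64"
      using card_vanishes[of l] ind l by (simp add: q r)
    ultimately show ?thesis
      by simp
  qed
  then have "(\<Sum>l\<leftarrow>ls. card {x \<in> Y. vanishes x l}) = (\<Sum>l\<leftarrow>ls. 15)"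
    by (intro arg_cong[where f = sum_list] map_cong) auto
  then have "(\<Sum>x\<in>Y. N x) = 645"
    unfolding N_def by (subst sum_length_filter) (simp_all add: sum_list_triv len)
  moreover have "(\<Sum>x\<in>Y. N x) = (\<Sum>x\<in>Y. if N x = 3 then 3 else 0)"
  proof (rule sum.cong)
    fix x
    assume x: "x \<in> Y"
    show "N x = (if N x = 3 then 3 else 0)"
    proof (cases "filter (vanishes x) ls")
      case Nil
      then show ?thesis by (simp add: N_def)
    next
      case (Cons l ms)
      then have "l \<in> set (filter (vanishes x) ls)"
        by simp
      then show ?thesis
        using N3[of l x] x by (auto simp: Y_def)
    qed
  qed simp
  \<comment> \<open>The sum is 43 * 15 = 645 and each functional counted carries three lines. The
    quotient 215 is not divisible by 3.\<close>
  ultimately have "card {x \<in> Y. N x = 3} = 215"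
    by (simp add: sum.If_cases Int_def)
  moreover have "CARD('q) - 1 dvd card {x \<in> Y. N x = 3}"
  proof (rule dvd_card_scalar_closed)
    fix a :: 'q and x :: "'q ^ 'r"
    assume "a \<noteq> 0" "x \<in> {x \<in> Y. N x = 3}"
    moreover from this have "vanishes (a *s x) = vanishes x"
      by (auto simp: vanishes_def fun_eq_iff)
    ultimately show "a *s x \<in> {x \<in> Y. N x = 3}"
      by (auto simp: Y_def N_def)
  qed (simp add: Y_def)
  ultimately show False
    by (simp add: q)
qed

section \<open>Verifying line systems by computation\<close>

text \<open>\<open>F2\<close> stands for a generator \<open>w\<close> with \<open>w\<^sup>2 = w + 1\<close>, and \<open>F3\<close> for \<open>w + 1\<close>.\<close>

datatype gf4 = F0 | F1 | F2 | F3

fun gf4_add :: "gf4 \<Rightarrow> gf4 \<Rightarrow> gf4" where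
  "gf4_add F0 y = y" | "gf4_add x F0 = x"
| "gf4_add F1 F1 = F0" | "gf4_add F1 F2 = F3" | "gf4_add F1 F3 = F2"
| "gf4_add F2 F1 = F3" | "gf4_add F2 F2 = F0" | "gf4_add F2 F3 = F1"
| "gf4_add F3 F1 = F2" | "gf4_add F3 F2 = F1" | "gf4_add F3 F3 = F0"

fun gf4_mult :: "gf4 \<Rightarrow> gf4 \<Rightarrow> gf4" where
  "gf4_mult F0 y = F0" | "gf4_mult F1 y = y"
| "gf4_mult F2 F0 = F0" | "gf4_mult F2 F1 = F2" | "gf4_mult F2 F2 = F3" | "gf4_mult F2 F3 = F1"
| "gf4_mult F3 F0 = F0" | "gf4_mult F3 F1 = F3" | "gf4_mult F3 F2 = F1" | "gf4_mult F3 F3 = F2"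

definition gf4_embedding :: "(gf4 \<Rightarrow> 'q::field) \<Rightarrow> bool" where
  "gf4_embedding f \<longleftrightarrow> bij f \<and> f F0 = 0 \<and> f F1 = 1 \<and>
     (\<forall>x y. f (gf4_add x y) = f x + f y \<and> f (gf4_mult x y) = f x * f y)"

text \<open>Translation by 1 permutes the field, so the sum of four ones is 0 and the characteristic
  is 2. For \<open>w\<close> other than 0 and 1 the square of \<open>w\<close> cannot be 0, 1 or
  \<open>w\<close>, which leaves \<open>w + 1\<close>.\<close>

lemma field_4_generator:
  assumes "CARD('q::{field,finite}) = 4"
  obtains w :: "'q::{field,finite}" where "(1::'q) + 1 = 0" "w * w = w + 1" "w \<noteq> 0" "w \<noteq> 1" "UNIV = {0, 1, w, w + 1}"
proof -
  have "(\<Sum>x\<in>UNIV. x + 1) = (\<Sum>x\<in>UNIV. x :: 'q)"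
    by (rule sum.reindex_bij_betw) (rule bij_plus_right)
  then have "of_nat 4 = (0 :: 'q)"
    by (simp add: sum.distrib assms)
  then have "(1 + 1) * (1 + 1) = (0 :: 'q)"
    by (simp add: algebra_simps)
  then have 2: "(1::'q) + 1 = 0"
    by (simp only: mult_eq_0_iff disj_absorb)
  have dbl: "x + x = 0" for x :: 'q
  proof -
    have "x + x = x * (1 + 1)"
      by (simp only: distrib_left mult_1_right)
    then show ?thesis
      by (simp only: 2 mult_zero_right)
  qed
  have "UNIV \<noteq> {0, 1 :: 'q}"
  proof
    assume "UNIV = {0, 1 :: 'q}"
    then have "CARD('q) = card {0, 1 :: 'q}"
      by simp
    then show False
      by (simp add: assms)
  qed
  then obtain w :: 'q where w: "w \<noteq> 0" "w \<noteq> 1"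
    by auto
  have w1: "w + 1 \<noteq> 0"
    using w(2) dbl[of 1] by (metis add_right_cancel)
  then have "card {0, 1, w, w + 1} = 4"
    using w by auto
  then have UNIV: "UNIV = {0, 1, w, w + 1}"
    by (intro card_subset_eq[symmetric]) (simp_all add: assms)
  have "w * w \<noteq> 1"
  proof
    assume "w * w = 1"
    then have "(w + 1) * (w + 1) = (1 + 1) + (w + w)"
      by (simp add: algebra_simps)
    then show False
      using w1 by (simp add: dbl 2 del: one_add_one)
  qed
  moreover have "w * w \<noteq> 0" "w * w \<noteq> w"
    using w by auto
  ultimately have "w * w = w + 1"
    using UNIV by blast
  with that 2 w UNIV show thesis
    by blast
qed

lemma gf4_embedding_exists:
  assumes "CARD('q::{field,finite}) = 4"
  obtains f :: "gf4 \<Rightarrow> 'q::{field,finite}" where "gf4_embedding f"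
proof -
  obtain w :: 'q where 2: "(1::'q) + 1 = 0" and ww: "w * w = w + 1"
    and w: "w \<noteq> 0" "w \<noteq> 1" and UNIV: "UNIV = {0, 1, w, w + 1}"
    using field_4_generator[OF assms] by blast
  have dbl: "x + x = 0" "x + (x + y) = y" for x y :: 'q
  proof -
    show x: "x + x = 0" for x :: 'q
    proof -
      have "x + x = x * (1 + 1)"
        by (simp only: distrib_left mult_1_right)
      then show ?thesis
        by (simp only: 2 mult_zero_right)
    qed
    show "x + (x + y) = y"
      by (simp add: x flip: add.assoc)
  qed
  define f where "f x = (case x of F0 \<Rightarrow> 0 | F1 \<Rightarrow> 1 | F2 \<Rightarrow> w | F3 \<Rightarrow> w + 1)" for x
  have "range f = UNIV"
  proof -
    have "{f F0, f F1, f F2, f F3} = UNIV"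
      using UNIV by (simp add: f_def)
    then show ?thesis
      by blast
  qed
  moreover have gf4: "(UNIV :: gf4 set) = {F0, F1, F2, F3}"
    using gf4.exhaust by blast
  have "finite (UNIV :: gf4 set)" "card (UNIV :: gf4 set) = CARD('q)"
    unfolding gf4 by (simp_all add: assms)
  ultimately have "bij f"
    by (simp add: bij_def eq_card_imp_inj_on)
  moreover have "f (gf4_add x y) = f x + f y" "f (gf4_mult x y) = f x * f y" for x y
    by (cases x; cases y; simp add: f_def algebra_simps ww dbl del: one_add_one)+
  ultimately have "gf4_embedding f"
    by (simp add: gf4_embedding_def f_def)
  then show thesis
    by (rule that)
qed

text \<open>The line spanned by \<open>a\<close> and \<open>b\<close> is encoded by the list of pairs \<open>(a\<^sub>i, b\<^sub>i)\<close>. Feeding the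
  coordinates of a functional \<open>x\<close> to \<open>step\<close> one by one accumulates the pair \<open>(x \<cdot> a, x \<cdot> b)\<close>; this
  shares the work between functionals with a common prefix. A hyperplane has a unique functional
  with leading coefficient \<open>1\<close>, so \<open>check_monic\<close> needs only those.\<close>

type_synonym column = "gf4 \<times> gf4"

fun step :: "gf4 \<Rightarrow> column \<times> column list \<Rightarrow> column \<times> column list" where
  "step x ((p, q), []) = ((p, q), [])"
| "step x ((p, q), (a, b) # cs) = ((gf4_add p (gf4_mult x a), gf4_add q (gf4_mult x b)), cs)"

text \<open>The bound \<open>s\<close> is a budget that every zero pair reduces, so a violation ends
  the scan at once.\<close>

fun count_zero_le :: "(column \<times> column list) list \<Rightarrow> nat \<Rightarrow> bool" where
  "count_zero_le [] s = True"
| "count_zero_le (((F0, F0), cs) # ss) 0 = False"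
| "count_zero_le (((F0, F0), cs) # ss) (Suc s) = count_zero_le ss s"
| "count_zero_le (_ # ss) s = count_zero_le ss s"

fun check_all :: "nat \<Rightarrow> nat \<Rightarrow> (column \<times> column list) list \<Rightarrow> bool" where
  "check_all s 0 ss = count_zero_le ss s"
| "check_all s (Suc k) ss \<longleftrightarrow>
     check_all s k (map (step F0) ss) \<and> check_all s k (map (step F1) ss) \<and>
     check_all s k (map (step F2) ss) \<and> check_all s k (map (step F3) ss)"

text \<open>Only the zero functional reaches the base case, and it is exempt.\<close>

fun check_monic :: "nat \<Rightarrow> nat \<Rightarrow> (column \<times> column list) list \<Rightarrow> bool" where
  "check_monic s 0 ss = True"
| "check_monic s (Suc k) ss \<longleftrightarrow>
     check_monic s k (map (step F0) ss) \<and> check_all s k (map (step F1) ss)"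

definition check :: "nat \<Rightarrow> nat \<Rightarrow> column list list \<Rightarrow> bool" where
  "check s k ls \<longleftrightarrow> list_all (\<lambda>l. length l = k) ls \<and> check_monic s k (map (Pair (F0, F0)) ls)"

section \<open>Correctness of the check\<close>

fun run :: "gf4 list \<Rightarrow> column \<times> column list \<Rightarrow> column" where
  "run [] st = fst st"
| "run (x # xs) st = run xs (step x st)"

lemma count_zero_le_iff:
  "count_zero_le ss s \<longleftrightarrow> length (filter (\<lambda>st. fst st = (F0, F0)) ss) \<le> s"
  by (induction ss s rule: count_zero_le.induct) auto

lemma check_all_run:
  "check_all s (length xs) ss \<Longrightarrow> length (filter (\<lambda>st. run xs st = (F0, F0)) ss) \<le> s"
proof (induction xs arbitrary: ss)
  case Nil
  then show ?case by (simp add: count_zero_le_iff)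
next
  case (Cons x xs)
  then have "check_all s (length xs) (map (step x) ss)"
    by (cases x) auto
  from Cons.IH[OF this] show ?case
    by (simp add: filter_map comp_def)
qed

lemma check_monic_run:
  "check_monic s (i + Suc (length xs)) ss \<Longrightarrow>
    length (filter (\<lambda>st. run (replicate i F0 @ F1 # xs) st = (F0, F0)) ss) \<le> s"
proof (induction i arbitrary: ss)
  case 0
  then show ?case
    using check_all_run[of s xs "map (step F1) ss"] by (simp add: filter_map comp_def)
next
  case (Suc i)
  then show ?case
    using Suc.IH[of "map (step F0) ss"] by (simp add: filter_map comp_def)
qed

lemma run_eq_sum:
  assumes f: "gf4_embedding f" and "length cs = length xs"
  shows "f (fst (run xs (p, cs))) = f (fst p) + (\<Sum>j<length xs. f (xs ! j) * f (fst (cs ! j)))"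
    and "f (snd (run xs (p, cs))) = f (snd p) + (\<Sum>j<length xs. f (xs ! j) * f (snd (cs ! j)))"
  using assms(2)
proof (induction xs arbitrary: p cs)
  case Nil
  {
    case 1
    then show ?case by simp
  next
    case 2
    then show ?case by simp
  }
next
  case (Cons x xs)
  have f_simps: "f (gf4_add a b) = f a + f b" "f (gf4_mult a b) = f a * f b" for a b
    using f by (auto simp: gf4_embedding_def)
  {
    case 1
    then obtain c cs' where cs: "cs = c # cs'" "length cs' = length xs"
      by (cases cs) auto
    show ?case
      using Cons.IH(1)[OF cs(2)]
      by (cases p; cases c) (simp add: cs(1) f_simps sum.lessThan_Suc_shift add.assoc del: sum.lessThan_Suc)
  next
    case 2
    then obtain c cs' where cs: "cs = c # cs'" "length cs' = length xs"
      by (cases cs) auto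
    show ?case
      using Cons.IH(2)[OF cs(2)]
      by (cases p; cases c) (simp add: cs(1) f_simps sum.lessThan_Suc_shift add.assoc del: sum.lessThan_Suc)
  }
qed

text \<open>Dividing a functional by its first nonzero coordinate, in the numbering
  \<open>e\<close>, keeps the lines on which it vanishes and brings it to the form
  \<open>replicate j F0 @ F1 # ys\<close> that \<open>check_monic\<close> covers.\<close>

lemma line_system_of_check:
  assumes "CARD('q::{field,finite}) = 4" "check s CARD('r) ls"
  obtains ms :: "(('q::{field,finite} ^ 'r) \<times> ('q ^ 'r)) list" where "length ms = length ls" "line_system s ms"
proof -
  obtain f :: "gf4 \<Rightarrow> 'q" where f: "gf4_embedding f"
    using gf4_embedding_exists[OF assms(1)] by blast
  then have inj: "f u = 0 \<longleftrightarrow> u = F0" for u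
    by (metis bij_is_inj gf4_embedding_def injD)
  obtain e :: "nat \<Rightarrow> 'r" where e: "bij_betw e {..<CARD('r)} UNIV"
    using ex_bij_betw_nat_finite[of "UNIV :: 'r set"] by (auto simp: atLeast0LessThan)
  define g where "g = the_inv_into {..<CARD('r)} e"
  have g: "g (e j) = j" if "j < CARD('r)" for j
    unfolding g_def using e that by (intro the_inv_into_f_f) (auto simp: bij_betw_def)
  define dec where "dec cs = ((\<chi> i. f (fst (cs ! g i)), \<chi> i. f (snd (cs ! g i))) :: ('q ^ 'r) \<times> ('q ^ 'r))"
    for cs
  have sum_e: "(\<Sum>i\<in>UNIV. h i) = (\<Sum>j<CARD('r). h (e j))" for h :: "'r \<Rightarrow> 'q"
    by (rule sum.reindex_bij_betw[OF e, symmetric])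
  have vanishes_dec: "vanishes x (dec cs) \<longleftrightarrow> run xs ((F0, F0), cs) = (F0, F0)"
    if len: "length cs = CARD('r)" "length xs = CARD('r)" and x: "\<And>j. j < CARD('r) \<Longrightarrow> x $ e j = f (xs ! j)"
    for x :: "'q ^ 'r" and cs xs
  proof -
    have "f F0 = 0"
      by (simp add: inj)
    then have "dotp x (fst (dec cs)) = f (fst (run xs ((F0, F0), cs)))"
      "dotp x (snd (dec cs)) = f (snd (run xs ((F0, F0), cs)))"
      using run_eq_sum[OF f, of cs xs "(F0, F0)"] len
      by (simp_all add: dotp_def sum_e dec_def g x)
    then show ?thesis
      by (simp add: vanishes_def inj prod_eq_iff)
  qed
  have "line_system s (map dec ls)"
    unfolding line_system_def
  proof (intro allI impI)
    fix x :: "'q ^ 'r"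
    assume "x \<noteq> 0"
    then obtain i where "x $ i \<noteq> 0"
      by (auto simp: vec_eq_iff)
    moreover obtain j where "i = e j" "j < CARD('r)"
      using e by (metis UNIV_I bij_betw_iff_bijections lessThan_iff)
    ultimately have "\<exists>j. j < CARD('r) \<and> x $ e j \<noteq> 0"
      by blast
    then obtain j where j: "j < CARD('r)" "x $ e j \<noteq> 0" and least: "\<And>k. k < j \<Longrightarrow> \<not> (k < CARD('r) \<and> x $ e k \<noteq> 0)"
      using exists_least_iff[of "\<lambda>j. j < CARD('r) \<and> x $ e j \<noteq> 0"] by blast
    define y where "y = inverse (x $ e j) *s x"
    have vy: "vanishes y = vanishes x"
      using j(2) by (auto simp: vanishes_def y_def fun_eq_iff)
    define ys where "ys = map (\<lambda>k. inv f (y $ e k)) [Suc j..<CARD('r)]"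
    define xs where "xs = replicate j F0 @ F1 # ys"
    have len: "length xs = CARD('r)" "j + Suc (length ys) = CARD('r)"
      using j(1) by (simp_all add: xs_def ys_def)
    have "y $ e k = f (xs ! k)" if k: "k < CARD('r)" for k
    proof -
      consider "k < j" | "k = j" | "j < k"
        by linarith
      then show ?thesis
      proof cases
        case 1
        then show ?thesis
          using least[of k] k f by (simp add: y_def xs_def nth_append gf4_embedding_def)
      next
        case 2
        then show ?thesis
          using j(2) f by (simp add: y_def xs_def nth_append gf4_embedding_def)
      next
        case 3
        then have "xs ! k = inv f (y $ e k)"
          using k nth_upt[of "Suc j" "k - Suc j" "CARD('r)"]
          by (simp add: xs_def ys_def nth_append nth_Cons')
        then show ?thesis
          using f by (simp add: gf4_embedding_def bij_is_surj surj_f_inv_f)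
      qed
    qed
    then have "length (filter (vanishes x) (map dec ls)) =
        length (filter (\<lambda>cs. run xs ((F0, F0), cs) = (F0, F0)) ls)"
      using assms(2) len(1) vanishes_dec[of _ xs y]
      by (simp add: vy[symmetric] filter_map comp_def check_def list_all_iff cong: filter_cong)
    also have "\<dots> \<le> s"
    proof -
      have "check_monic s (j + Suc (length ys)) (map (Pair (F0, F0)) ls)"
        using assms(2) by (simp only: check_def len(2))
      from check_monic_run[OF this] show ?thesis
        by (simp add: filter_map comp_def xs_def)
    qed
    finally show "length (filter (vanishes x) (map dec ls)) \<le> s" .
  qed
  then show thesis
    using that[of "map dec ls"] by simp
qed

text \<open>As \<open>run\<close> on a row yields the products of that row with both spanning
  vectors, this applies the matrix \<open>A\<close> to the line.\<close>

definition act :: "gf4 list list \<Rightarrow> column list \<Rightarrow> column list" where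
  "act A l = map (\<lambda>row. run row ((F0, F0), l)) A"

fun orbit :: "nat \<Rightarrow> gf4 list list \<Rightarrow> column list \<Rightarrow> column list list" where
  "orbit 0 A l = []"
| "orbit (Suc k) A l = l # orbit k A (act A l)"

definition orbits :: "gf4 list list \<Rightarrow> (nat \<times> column list list) list \<Rightarrow> column list list" where
  "orbits A rs = concat (map (\<lambda>(k, ls). concat (map (orbit k A) ls)) rs)"

section \<open>Explicit line systems\<close>

text \<open>The systems of sizes up to 222, except the one of size 64, were found by computer search, mostly
  among the systems invariant under the cyclic group generated by a matrix; each listed line then
  represents its orbit, whose length is given in front.\<close>

definition lines_20 :: "column list list" where
  "lines_20 = orbits
    [[F2, F3, F3, F1, F3],
     [F1, F1, F1, F2, F2],
     [F1, F0, F2, F1, F1],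
     [F0, F1, F2, F0, F3],
     [F2, F3, F2, F0, F1]]
    [(5,
      [[(F1, F1), (F0, F1), (F3, F0), (F0, F2), (F0, F1)],
       [(F1, F0), (F2, F1), (F3, F0), (F0, F1), (F0, F1)],
       [(F1, F1), (F3, F1), (F3, F1), (F0, F1), (F0, F1)],
       [(F1, F1), (F0, F3), (F0, F3), (F2, F2), (F0, F1)]])]"

lemma check_20: "check 2 5 lines_20" "length lines_20 = 20"
  by code_simp+

definition lines_39 :: "column list list" where
  "lines_39 = orbits
    [[F2, F1, F0, F0, F1],
     [F1, F2, F0, F2, F0],
     [F0, F0, F1, F0, F0],
     [F0, F0, F0, F1, F0],
     [F2, F2, F0, F2, F0]]
    [(3,
      [[(F1, F1), (F0, F3), (F0, F3), (F0, F1), (F0, F1)],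
       [(F1, F1), (F2, F2), (F0, F3), (F0, F3), (F0, F1)],
       [(F1, F1), (F3, F1), (F0, F1), (F0, F3), (F0, F1)],
       [(F1, F1), (F0, F3), (F1, F3), (F0, F2), (F0, F1)],
       [(F0, F1), (F1, F3), (F1, F0), (F0, F1), (F0, F1)],
       [(F1, F1), (F0, F0), (F2, F0), (F0, F1), (F0, F0)],
       [(F1, F1), (F2, F1), (F2, F2), (F0, F3), (F0, F1)],
       [(F1, F1), (F3, F0), (F2, F2), (F0, F1), (F0, F1)],
       [(F0, F1), (F1, F3), (F3, F0), (F0, F1), (F0, F3)],
       [(F1, F1), (F3, F1), (F3, F0), (F0, F2), (F0, F1)],
       [(F1, F1), (F2, F0), (F1, F0), (F1, F3), (F0, F1)],
       [(F1, F1), (F2, F1), (F2, F0), (F1, F1), (F0, F1)],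
       [(F0, F1), (F1, F0), (F0, F0), (F3, F0), (F0, F2)]])]"

lemma check_39: "check 3 5 lines_39" "length lines_39 = 39"
  by code_simp+

definition lines_75 :: "column list list" where
  "lines_75 = orbits
    [[F3, F0, F1, F2, F2],
     [F1, F2, F2, F2, F2],
     [F3, F0, F1, F0, F3],
     [F2, F3, F0, F1, F1],
     [F2, F2, F1, F3, F1]]
    [(5,
      [[(F1, F1), (F0, F2), (F0, F1), (F0, F0), (F0, F1)],
       [(F0, F1), (F1, F0), (F0, F3), (F0, F0), (F0, F3)],
       [(F1, F1), (F1, F2), (F0, F1), (F0, F2), (F0, F1)],
       [(F1, F1), (F2, F1), (F0, F2), (F0, F3), (F0, F1)],
       [(F1, F1), (F3, F0), (F0, F0), (F0, F0), (F0, F1)],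
       [(F1, F1), (F0, F2), (F1, F3), (F0, F3), (F0, F1)],
       [(F0, F1), (F1, F2), (F1, F0), (F0, F2), (F0, F1)],
       [(F1, F1), (F2, F1), (F1, F3), (F0, F2), (F0, F1)],
       [(F1, F0), (F3, F1), (F1, F2), (F0, F1), (F0, F1)],
       [(F1, F1), (F0, F3), (F2, F1), (F0, F1), (F0, F1)],
       [(F1, F1), (F1, F3), (F2, F0), (F0, F2), (F0, F1)],
       [(F1, F1), (F3, F2), (F2, F0), (F0, F3), (F0, F1)],
       [(F1, F1), (F2, F1), (F3, F2), (F0, F0), (F0, F1)],
       [(F1, F1), (F2, F0), (F1, F3), (F1, F0), (F0, F1)],
       [(F1, F1), (F0, F3), (F2, F2), (F1, F0), (F0, F1)]])]"

lemma check_75: "check 5 5 lines_75" "length lines_75 = 75"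
  by code_simp+

definition lines_90 :: "column list list" where
  "lines_90 = orbits
    [[F1, F1, F0, F0, F0],
     [F0, F1, F0, F0, F0],
     [F0, F0, F1, F1, F1],
     [F0, F0, F0, F2, F0],
     [F0, F0, F0, F0, F3]]
    [(6,
      [[(F0, F1), (F1, F2), (F2, F0), (F0, F1), (F0, F0)],
       [(F1, F1), (F2, F0), (F2, F1), (F0, F0), (F0, F1)],
       [(F0, F1), (F0, F2), (F0, F3), (F1, F0), (F0, F1)],
       [(F0, F1), (F1, F0), (F0, F2), (F1, F0), (F0, F2)],
       [(F0, F1), (F1, F1), (F0, F1), (F1, F0), (F0, F3)],
       [(F1, F1), (F2, F3), (F0, F3), (F1, F2), (F0, F1)],
       [(F1, F1), (F3, F2), (F0, F0), (F1, F0), (F0, F1)],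
       [(F1, F1), (F3, F1), (F0, F0), (F1, F3), (F0, F1)],
       [(F1, F0), (F0, F1), (F1, F0), (F1, F2), (F0, F1)],
       [(F1, F1), (F2, F3), (F1, F3), (F1, F0), (F0, F1)],
       [(F1, F1), (F0, F3), (F2, F0), (F1, F1), (F0, F1)],
       [(F0, F0), (F1, F0), (F2, F1), (F1, F0), (F0, F1)],
       [(F0, F1), (F1, F1), (F2, F0), (F1, F0), (F0, F2)],
       [(F0, F1), (F1, F1), (F3, F2), (F1, F0), (F0, F2)]]),
     (3,
      [[(F0, F0), (F0, F0), (F1, F0), (F0, F1), (F0, F1)],
       [(F1, F0), (F0, F0), (F3, F1), (F0, F1), (F0, F1)]])]"

lemma check_90: "check 6 5 lines_90" "length lines_90 = 90"
  by code_simp+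

definition lines_107 :: "column list list" where
  "lines_107 = orbits
    [[F1, F1, F0, F1, F0],
     [F3, F2, F2, F3, F2],
     [F1, F2, F2, F3, F3],
     [F0, F2, F0, F3, F0],
     [F1, F0, F3, F3, F2]]
    [(7,
      [[(F1, F1), (F0, F0), (F0, F2), (F0, F1), (F0, F1)],
       [(F1, F1), (F0, F3), (F0, F1), (F0, F3), (F0, F1)],
       [(F0, F1), (F1, F0), (F0, F3), (F0, F0), (F0, F0)],
       [(F1, F1), (F1, F3), (F0, F3), (F0, F0), (F0, F1)],
       [(F1, F1), (F1, F0), (F0, F1), (F0, F2), (F0, F1)],
       [(F1, F1), (F2, F2), (F0, F2), (F0, F2), (F0, F1)],
       [(F1, F1), (F2, F2), (F0, F3), (F0, F3), (F0, F1)],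
       [(F1, F0), (F3, F1), (F0, F0), (F0, F0), (F0, F1)],
       [(F1, F0), (F3, F1), (F0, F1), (F0, F0), (F0, F1)],
       [(F0, F1), (F0, F1), (F1, F0), (F0, F2), (F0, F1)],
       [(F1, F1), (F1, F2), (F1, F1), (F0, F1), (F0, F0)],
       [(F1, F1), (F2, F1), (F1, F2), (F0, F1), (F0, F0)],
       [(F1, F0), (F2, F1), (F1, F0), (F0, F1), (F0, F1)],
       [(F1, F1), (F3, F3), (F2, F0), (F0, F3), (F0, F1)],
       [(F1, F1), (F3, F0), (F1, F0), (F1, F1), (F0, F1)]]),
     (1,
      [[(F1, F0), (F0, F0), (F2, F1), (F0, F0), (F0, F1)],
       [(F1, F0), (F0, F0), (F2, F1), (F0, F0), (F0, F1)]])]"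

lemma check_107: "check 7 5 lines_107" "length lines_107 = 107"
  by code_simp+

definition lines_141 :: "column list list" where
  "lines_141 = orbits
    [[F1, F1, F0, F1, F0],
     [F3, F2, F2, F3, F2],
     [F1, F2, F2, F3, F3],
     [F0, F2, F0, F3, F0],
     [F1, F0, F3, F3, F2]]
    [(7,
      [[(F1, F0), (F0, F1), (F0, F2), (F0, F1), (F0, F0)],
       [(F1, F1), (F0, F2), (F0, F1), (F0, F1), (F0, F1)],
       [(F0, F1), (F1, F0), (F0, F2), (F0, F2), (F0, F0)],
       [(F1, F1), (F1, F3), (F0, F1), (F0, F0), (F0, F0)],
       [(F1, F1), (F1, F3), (F0, F3), (F0, F1), (F0, F0)],
       [(F1, F1), (F2, F0), (F0, F2), (F0, F1), (F0, F0)],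
       [(F1, F1), (F2, F0), (F0, F3), (F0, F1), (F0, F0)],
       [(F1, F0), (F3, F1), (F0, F2), (F0, F1), (F0, F1)],
       [(F1, F0), (F3, F1), (F0, F3), (F0, F3), (F0, F1)],
       [(F0, F0), (F0, F1), (F1, F0), (F0, F1), (F0, F2)],
       [(F0, F1), (F0, F0), (F1, F0), (F0, F3), (F0, F2)],
       [(F0, F1), (F1, F0), (F1, F0), (F0, F1), (F0, F0)],
       [(F1, F1), (F1, F3), (F1, F1), (F0, F2), (F0, F1)],
       [(F0, F0), (F1, F1), (F2, F1), (F0, F1), (F0, F1)],
       [(F1, F0), (F1, F0), (F2, F1), (F0, F1), (F0, F1)],
       [(F1, F1), (F0, F2), (F3, F2), (F0, F3), (F0, F1)],
       [(F1, F0), (F2, F0), (F3, F1), (F0, F2), (F0, F1)],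
       [(F1, F1), (F3, F3), (F3, F0), (F0, F1), (F0, F1)],
       [(F1, F1), (F3, F3), (F0, F2), (F1, F2), (F0, F1)],
       [(F1, F1), (F0, F3), (F1, F0), (F1, F1), (F0, F1)]]),
     (1,
      [[(F1, F0), (F0, F0), (F2, F1), (F0, F0), (F0, F1)]])]"

lemma check_141: "check 9 5 lines_141" "length lines_141 = 141"
  by code_simp+

text \<open>The point multiplicities were found first: they form a Griesmer code of length 780.\<close>

definition lines_156 :: "column list list" where
  "lines_156 =
    [[(F1, F0), (F0, F1), (F0, F0), (F0, F1), (F0, F0)],
     [(F1, F1), (F0, F3), (F0, F0), (F0, F1), (F0, F0)],
     [(F0, F0), (F1, F1), (F0, F0), (F0, F3), (F0, F1)],
     [(F0, F0), (F1, F1), (F0, F3), (F0, F3), (F0, F1)],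
     [(F1, F1), (F1, F0), (F0, F2), (F0, F1), (F0, F0)],
     [(F1, F1), (F1, F3), (F0, F3), (F0, F1), (F0, F1)],
     [(F1, F1), (F3, F0), (F0, F3), (F0, F1), (F0, F0)],
     [(F1, F1), (F3, F0), (F0, F3), (F0, F2), (F0, F1)],
     [(F1, F1), (F0, F3), (F1, F1), (F0, F1), (F0, F1)],
     [(F1, F1), (F0, F2), (F1, F1), (F0, F2), (F0, F1)],
     [(F0, F1), (F1, F2), (F1, F0), (F0, F2), (F0, F2)],
     [(F0, F1), (F1, F3), (F1, F0), (F0, F2), (F0, F2)],
     [(F1, F1), (F1, F3), (F1, F3), (F0, F1), (F0, F1)],
     [(F1, F1), (F1, F1), (F1, F3), (F0, F2), (F0, F1)],
     [(F1, F0), (F2, F0), (F1, F0), (F0, F0), (F0, F1)],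
     [(F1, F1), (F2, F2), (F1, F2), (F0, F0), (F0, F1)],
     [(F1, F1), (F3, F3), (F1, F0), (F0, F1), (F0, F1)],
     [(F1, F1), (F3, F0), (F1, F0), (F0, F2), (F0, F1)],
     [(F1, F1), (F0, F3), (F2, F3), (F0, F0), (F0, F1)],
     [(F1, F1), (F0, F3), (F2, F1), (F0, F1), (F0, F1)],
     [(F0, F1), (F1, F1), (F2, F0), (F0, F3), (F0, F2)],
     [(F0, F1), (F1, F2), (F2, F0), (F0, F3), (F0, F2)],
     [(F1, F1), (F1, F1), (F2, F0), (F0, F0), (F0, F1)],
     [(F1, F1), (F1, F1), (F2, F0), (F0, F3), (F0, F1)],
     [(F1, F1), (F2, F1), (F2, F0), (F0, F2), (F0, F1)],
     [(F1, F1), (F2, F1), (F2, F2), (F0, F3), (F0, F1)],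
     [(F1, F1), (F3, F0), (F2, F2), (F0, F1), (F0, F1)],
     [(F1, F1), (F3, F0), (F2, F3), (F0, F1), (F0, F1)],
     [(F1, F1), (F0, F2), (F3, F1), (F0, F0), (F0, F1)],
     [(F1, F1), (F0, F2), (F3, F0), (F0, F2), (F0, F1)],
     [(F0, F0), (F1, F0), (F3, F0), (F0, F1), (F0, F0)],
     [(F1, F1), (F1, F3), (F3, F1), (F0, F2), (F0, F1)],
     [(F1, F1), (F1, F3), (F3, F3), (F0, F2), (F0, F1)],
     [(F1, F1), (F2, F0), (F3, F2), (F0, F1), (F0, F1)],
     [(F1, F1), (F2, F0), (F3, F3), (F0, F3), (F0, F1)],
     [(F1, F0), (F3, F0), (F3, F1), (F0, F0), (F0, F1)],
     [(F1, F0), (F3, F0), (F3, F1), (F0, F3), (F0, F1)],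
     [(F0, F0), (F0, F1), (F0, F0), (F1, F0), (F0, F1)],
     [(F1, F1), (F0, F1), (F0, F1), (F1, F2), (F0, F1)],
     [(F1, F1), (F0, F1), (F0, F2), (F1, F2), (F0, F1)],
     [(F0, F1), (F1, F3), (F0, F2), (F1, F0), (F0, F3)],
     [(F1, F1), (F1, F1), (F0, F1), (F1, F2), (F0, F1)],
     [(F1, F1), (F1, F2), (F0, F2), (F1, F3), (F0, F1)],
     [(F1, F1), (F3, F1), (F0, F1), (F1, F0), (F0, F1)],
     [(F1, F1), (F3, F3), (F0, F2), (F1, F2), (F0, F1)],
     [(F1, F0), (F0, F1), (F1, F0), (F1, F0), (F0, F1)],
     [(F0, F1), (F1, F0), (F1, F3), (F1, F0), (F0, F1)],
     [(F0, F1), (F1, F0), (F1, F2), (F1, F0), (F0, F3)],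
     [(F1, F1), (F1, F1), (F1, F3), (F1, F1), (F0, F1)],
     [(F1, F1), (F1, F3), (F1, F0), (F1, F3), (F0, F1)],
     [(F1, F1), (F1, F1), (F1, F1), (F1, F3), (F0, F1)],
     [(F1, F0), (F3, F0), (F1, F1), (F1, F0), (F0, F1)],
     [(F1, F1), (F3, F3), (F1, F1), (F1, F0), (F0, F1)],
     [(F1, F1), (F3, F0), (F1, F3), (F1, F0), (F0, F1)],
     [(F1, F1), (F0, F3), (F2, F3), (F1, F0), (F0, F1)],
     [(F0, F1), (F1, F3), (F2, F1), (F1, F0), (F0, F3)],
     [(F1, F0), (F1, F1), (F2, F2), (F1, F0), (F0, F1)],
     [(F1, F1), (F1, F2), (F2, F2), (F1, F3), (F0, F1)],
     [(F1, F1), (F2, F0), (F2, F0), (F1, F0), (F0, F1)],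
     [(F1, F1), (F2, F1), (F2, F0), (F1, F2), (F0, F1)],
     [(F1, F1), (F3, F0), (F2, F1), (F1, F1), (F0, F1)],
     [(F1, F1), (F3, F0), (F2, F2), (F1, F1), (F0, F1)],
     [(F1, F1), (F3, F1), (F2, F3), (F1, F3), (F0, F1)],
     [(F1, F1), (F0, F2), (F3, F1), (F1, F3), (F0, F1)],
     [(F0, F1), (F1, F1), (F3, F0), (F1, F0), (F0, F1)],
     [(F1, F1), (F1, F2), (F3, F1), (F1, F0), (F0, F1)],
     [(F1, F1), (F1, F3), (F3, F0), (F1, F1), (F0, F1)],
     [(F1, F1), (F1, F3), (F3, F3), (F1, F1), (F0, F1)],
     [(F1, F1), (F2, F0), (F3, F2), (F1, F2), (F0, F1)],
     [(F1, F1), (F2, F1), (F3, F2), (F1, F3), (F0, F1)],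
     [(F1, F0), (F3, F1), (F3, F1), (F1, F0), (F0, F1)],
     [(F1, F1), (F3, F1), (F3, F3), (F1, F0), (F0, F1)],
     [(F1, F1), (F0, F2), (F0, F0), (F2, F0), (F0, F1)],
     [(F1, F1), (F0, F0), (F0, F1), (F2, F0), (F0, F1)],
     [(F0, F1), (F1, F1), (F0, F3), (F2, F0), (F0, F1)],
     [(F1, F1), (F1, F3), (F0, F2), (F2, F2), (F0, F1)],
     [(F1, F1), (F2, F3), (F0, F0), (F2, F0), (F0, F1)],
     [(F1, F1), (F2, F1), (F0, F2), (F2, F1), (F0, F1)],
     [(F1, F1), (F3, F2), (F0, F1), (F2, F1), (F0, F1)],
     [(F1, F1), (F3, F1), (F0, F3), (F2, F2), (F0, F1)],
     [(F1, F1), (F3, F1), (F0, F0), (F2, F3), (F0, F1)],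
     [(F0, F1), (F0, F2), (F1, F2), (F2, F0), (F0, F1)],
     [(F0, F1), (F0, F2), (F1, F3), (F2, F0), (F0, F1)],
     [(F1, F1), (F0, F3), (F1, F0), (F2, F0), (F0, F1)],
     [(F1, F0), (F0, F1), (F1, F3), (F2, F0), (F0, F1)],
     [(F0, F1), (F1, F1), (F1, F1), (F2, F0), (F0, F1)],
     [(F1, F1), (F1, F1), (F1, F2), (F2, F0), (F0, F1)],
     [(F1, F1), (F1, F2), (F1, F3), (F2, F3), (F0, F1)],
     [(F1, F1), (F2, F1), (F1, F2), (F2, F1), (F0, F1)],
     [(F1, F1), (F2, F1), (F1, F3), (F2, F2), (F0, F1)],
     [(F1, F0), (F3, F1), (F1, F1), (F2, F0), (F0, F1)],
     [(F1, F1), (F3, F2), (F1, F3), (F2, F0), (F0, F1)],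
     [(F1, F1), (F3, F0), (F1, F1), (F2, F2), (F0, F1)],
     [(F1, F0), (F0, F0), (F2, F0), (F2, F1), (F0, F1)],
     [(F1, F1), (F0, F2), (F2, F3), (F2, F1), (F0, F1)],
     [(F0, F1), (F1, F0), (F2, F3), (F2, F0), (F0, F1)],
     [(F0, F1), (F1, F0), (F2, F2), (F2, F0), (F0, F3)],
     [(F1, F1), (F1, F2), (F2, F3), (F2, F2), (F0, F1)],
     [(F1, F1), (F1, F1), (F2, F0), (F2, F3), (F0, F1)],
     [(F1, F1), (F2, F0), (F2, F1), (F2, F3), (F0, F1)],
     [(F1, F0), (F3, F0), (F2, F0), (F2, F1), (F0, F1)],
     [(F1, F1), (F3, F1), (F2, F0), (F2, F1), (F0, F1)],
     [(F1, F0), (F3, F1), (F2, F3), (F2, F1), (F0, F1)],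
     [(F1, F1), (F0, F0), (F3, F0), (F2, F0), (F0, F1)],
     [(F1, F1), (F0, F2), (F3, F0), (F2, F2), (F0, F1)],
     [(F0, F1), (F1, F3), (F3, F0), (F2, F0), (F0, F3)],
     [(F1, F1), (F1, F1), (F3, F1), (F2, F0), (F0, F1)],
     [(F1, F0), (F1, F1), (F3, F2), (F2, F1), (F0, F1)],
     [(F1, F1), (F2, F3), (F3, F2), (F2, F0), (F0, F1)],
     [(F1, F1), (F2, F0), (F3, F1), (F2, F1), (F0, F1)],
     [(F1, F1), (F2, F0), (F3, F0), (F2, F3), (F0, F1)],
     [(F1, F1), (F3, F2), (F3, F0), (F2, F0), (F0, F1)],
     [(F1, F1), (F3, F0), (F3, F0), (F2, F3), (F0, F1)],
     [(F1, F1), (F0, F3), (F0, F0), (F3, F2), (F0, F1)],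
     [(F1, F1), (F0, F0), (F0, F2), (F3, F2), (F0, F1)],
     [(F0, F1), (F1, F1), (F0, F2), (F3, F0), (F0, F1)],
     [(F0, F1), (F1, F3), (F0, F3), (F3, F0), (F0, F3)],
     [(F1, F1), (F1, F0), (F0, F2), (F3, F0), (F0, F1)],
     [(F1, F1), (F1, F2), (F0, F0), (F3, F1), (F0, F1)],
     [(F1, F1), (F1, F2), (F0, F3), (F3, F3), (F0, F1)],
     [(F1, F1), (F2, F0), (F0, F1), (F3, F0), (F0, F1)],
     [(F1, F0), (F2, F1), (F0, F0), (F3, F1), (F0, F1)],
     [(F1, F1), (F3, F0), (F0, F1), (F3, F3), (F0, F1)],
     [(F0, F1), (F0, F2), (F1, F2), (F3, F0), (F0, F3)],
     [(F0, F1), (F0, F2), (F1, F3), (F3, F0), (F0, F3)],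
     [(F1, F0), (F0, F1), (F1, F3), (F3, F0), (F0, F1)],
     [(F1, F1), (F0, F2), (F1, F3), (F3, F2), (F0, F1)],
     [(F0, F1), (F1, F0), (F1, F2), (F3, F0), (F0, F1)],
     [(F0, F0), (F1, F1), (F1, F2), (F3, F2), (F0, F1)],
     [(F1, F0), (F1, F1), (F1, F2), (F3, F0), (F0, F1)],
     [(F1, F0), (F1, F1), (F1, F1), (F3, F1), (F0, F1)],
     [(F1, F1), (F1, F3), (F1, F1), (F3, F3), (F0, F1)],
     [(F1, F1), (F2, F0), (F1, F2), (F3, F0), (F0, F1)],
     [(F1, F1), (F2, F0), (F1, F0), (F3, F3), (F0, F1)],
     [(F1, F1), (F3, F1), (F1, F0), (F3, F1), (F0, F1)],
     [(F1, F1), (F3, F3), (F1, F2), (F3, F2), (F0, F1)],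
     [(F1, F1), (F0, F0), (F2, F1), (F3, F2), (F0, F1)],
     [(F1, F1), (F0, F3), (F2, F1), (F3, F3), (F0, F1)],
     [(F0, F0), (F1, F1), (F2, F1), (F3, F1), (F0, F1)],
     [(F0, F1), (F1, F0), (F2, F3), (F3, F0), (F0, F3)],
     [(F1, F1), (F1, F3), (F2, F1), (F3, F1), (F0, F1)],
     [(F1, F0), (F1, F1), (F2, F3), (F3, F1), (F0, F1)],
     [(F1, F1), (F2, F1), (F2, F3), (F3, F0), (F0, F1)],
     [(F1, F1), (F2, F1), (F2, F1), (F3, F1), (F0, F1)],
     [(F1, F0), (F2, F1), (F2, F2), (F3, F1), (F0, F1)],
     [(F1, F0), (F3, F0), (F2, F1), (F3, F1), (F0, F1)],
     [(F1, F1), (F3, F2), (F2, F3), (F3, F1), (F0, F1)],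
     [(F1, F1), (F0, F3), (F3, F1), (F3, F0), (F0, F1)],
     [(F1, F1), (F0, F0), (F3, F3), (F3, F1), (F0, F1)],
     [(F0, F1), (F1, F0), (F3, F1), (F3, F0), (F0, F2)],
     [(F1, F1), (F1, F2), (F3, F2), (F3, F0), (F0, F1)],
     [(F1, F1), (F1, F0), (F3, F0), (F3, F1), (F0, F1)],
     [(F1, F1), (F1, F1), (F3, F3), (F3, F1), (F0, F1)],
     [(F1, F1), (F2, F1), (F3, F0), (F3, F1), (F0, F1)],
     [(F1, F1), (F3, F3), (F3, F2), (F3, F1), (F0, F1)],
     [(F1, F1), (F3, F1), (F3, F1), (F3, F3), (F0, F1)]]"

lemma check_156: "check 10 5 lines_156" "length lines_156 = 156"
  by code_simp+

definition lines_175 :: "column list list" where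
  "lines_175 = orbits
    [[F1, F0, F2, F3, F1],
     [F0, F0, F3, F0, F3],
     [F0, F1, F0, F2, F3],
     [F0, F1, F0, F0, F1],
     [F0, F0, F1, F1, F1]]
    [(7,
      [[(F0, F1), (F1, F0), (F0, F0), (F0, F1), (F0, F2)],
       [(F0, F1), (F1, F0), (F0, F1), (F0, F3), (F0, F2)],
       [(F0, F1), (F1, F0), (F0, F2), (F0, F2), (F0, F3)],
       [(F1, F0), (F1, F0), (F0, F1), (F0, F0), (F0, F0)],
       [(F1, F0), (F1, F0), (F0, F0), (F0, F0), (F0, F1)],
       [(F1, F1), (F1, F3), (F0, F3), (F0, F3), (F0, F1)],
       [(F1, F1), (F2, F1), (F0, F1), (F0, F1), (F0, F0)],
       [(F1, F0), (F2, F1), (F0, F1), (F0, F0), (F0, F1)],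
       [(F1, F1), (F2, F1), (F0, F3), (F0, F1), (F0, F1)],
       [(F0, F0), (F0, F0), (F1, F1), (F0, F2), (F0, F1)],
       [(F0, F1), (F0, F3), (F1, F0), (F0, F2), (F0, F2)],
       [(F1, F1), (F0, F2), (F1, F0), (F0, F3), (F0, F1)],
       [(F0, F1), (F1, F3), (F1, F0), (F0, F1), (F0, F0)],
       [(F0, F1), (F1, F1), (F1, F0), (F0, F3), (F0, F1)],
       [(F1, F1), (F1, F1), (F1, F3), (F0, F1), (F0, F1)],
       [(F1, F1), (F3, F3), (F1, F0), (F0, F2), (F0, F1)],
       [(F1, F1), (F0, F3), (F2, F2), (F0, F0), (F0, F1)],
       [(F1, F1), (F0, F3), (F2, F1), (F0, F3), (F0, F1)],
       [(F1, F1), (F2, F1), (F3, F0), (F0, F0), (F0, F1)],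
       [(F1, F1), (F0, F2), (F0, F2), (F1, F0), (F0, F1)],
       [(F0, F0), (F1, F1), (F0, F3), (F1, F0), (F0, F1)],
       [(F1, F1), (F2, F2), (F0, F2), (F1, F2), (F0, F1)],
       [(F1, F1), (F3, F2), (F1, F3), (F1, F0), (F0, F1)],
       [(F1, F1), (F3, F2), (F1, F1), (F1, F2), (F0, F1)],
       [(F1, F1), (F0, F0), (F2, F0), (F1, F1), (F0, F1)]])]"

lemma check_175: "check 11 5 lines_175" "length lines_175 = 175"
  by code_simp+

text \<open>Prescribing that 14 hyperplanes contain six lines each makes the search succeed. They form two
  disjoint Baer subplanes of planes of the dual space that meet in a point.\<close>

definition lines_222 :: "column list list" where
  "lines_222 = orbits
    [[F0, F0, F1, F2, F1],
     [F0, F0, F1, F3, F0],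
     [F0, F0, F2, F0, F0],
     [F0, F3, F1, F0, F0],
     [F1, F0, F0, F0, F0]]
    [(6,
      [[(F0, F0), (F1, F0), (F0, F1), (F0, F0), (F0, F1)],
       [(F1, F1), (F0, F1), (F1, F2), (F0, F3), (F0, F1)],
       [(F0, F1), (F1, F3), (F1, F0), (F0, F2), (F0, F2)],
       [(F0, F1), (F1, F1), (F1, F0), (F0, F0), (F0, F3)],
       [(F0, F1), (F1, F0), (F1, F0), (F0, F1), (F0, F3)],
       [(F1, F1), (F1, F2), (F1, F3), (F0, F1), (F0, F0)],
       [(F1, F0), (F1, F1), (F1, F2), (F0, F1), (F0, F1)],
       [(F1, F1), (F1, F2), (F1, F0), (F0, F3), (F0, F1)],
       [(F1, F1), (F2, F0), (F1, F0), (F0, F2), (F0, F1)],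
       [(F1, F1), (F2, F1), (F1, F1), (F0, F2), (F0, F1)],
       [(F1, F1), (F2, F1), (F1, F2), (F0, F3), (F0, F1)],
       [(F1, F1), (F3, F0), (F1, F1), (F0, F2), (F0, F1)],
       [(F1, F1), (F0, F2), (F2, F1), (F0, F2), (F0, F1)],
       [(F1, F1), (F0, F3), (F2, F2), (F0, F2), (F0, F1)],
       [(F0, F1), (F1, F1), (F2, F0), (F0, F3), (F0, F1)],
       [(F1, F1), (F1, F3), (F2, F1), (F0, F3), (F0, F1)],
       [(F1, F1), (F2, F0), (F2, F0), (F0, F3), (F0, F1)],
       [(F1, F1), (F2, F0), (F2, F3), (F0, F3), (F0, F1)],
       [(F1, F0), (F3, F1), (F2, F1), (F0, F3), (F0, F1)],
       [(F1, F1), (F3, F0), (F2, F3), (F0, F3), (F0, F1)],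
       [(F1, F1), (F0, F3), (F3, F3), (F0, F0), (F0, F1)],
       [(F1, F1), (F0, F3), (F3, F0), (F0, F2), (F0, F1)],
       [(F1, F1), (F1, F2), (F3, F2), (F0, F3), (F0, F1)],
       [(F1, F1), (F1, F3), (F3, F3), (F0, F3), (F0, F1)],
       [(F1, F1), (F3, F0), (F3, F2), (F0, F2), (F0, F1)],
       [(F1, F1), (F3, F1), (F3, F3), (F0, F2), (F0, F1)],
       [(F1, F1), (F0, F2), (F0, F2), (F1, F1), (F0, F1)],
       [(F0, F1), (F1, F1), (F0, F3), (F1, F0), (F0, F2)],
       [(F0, F1), (F1, F1), (F0, F0), (F1, F0), (F0, F3)],
       [(F1, F1), (F2, F0), (F0, F2), (F1, F2), (F0, F1)],
       [(F1, F0), (F0, F1), (F1, F0), (F1, F0), (F0, F1)],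
       [(F1, F1), (F0, F2), (F1, F1), (F1, F2), (F0, F1)],
       [(F1, F1), (F1, F3), (F0, F2), (F2, F3), (F0, F1)],
       [(F1, F1), (F0, F3), (F1, F2), (F2, F2), (F0, F1)]]),
     (3,
      [[(F0, F1), (F0, F3), (F1, F0), (F0, F3), (F0, F2)],
       [(F0, F1), (F0, F2), (F1, F0), (F0, F2), (F0, F3)],
       [(F1, F1), (F0, F1), (F0, F0), (F1, F0), (F0, F1)],
       [(F1, F0), (F1, F1), (F0, F2), (F1, F0), (F0, F1)]]),
     (2,
      [[(F1, F0), (F3, F1), (F0, F0), (F0, F0), (F0, F1)],
       [(F1, F1), (F2, F3), (F0, F0), (F1, F2), (F0, F1)]]),
     (1,
      [[(F1, F1), (F1, F0), (F0, F0), (F1, F0), (F0, F1)],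
       [(F1, F1), (F1, F0), (F1, F0), (F1, F0), (F0, F1)]])]"

lemma check_222: "check 14 5 lines_222" "length lines_222 = 222"
  by code_simp+

text \<open>The lines spanned by \<open>(1, 0, x)\<close> and \<open>(0, 1, w x)\<close>, where \<open>x\<close> ranges over the field with 64
  elements and \<open>w\<close> generates its multiplicative group. They partition the points outside the plane
  \<open>E\<close> on which the first two coordinates vanish, so the hyperplanes through \<open>E\<close> contain none of
  them and all other hyperplanes contain four.\<close>

definition lines_64 :: "column list list" where
  "lines_64 = orbits
    [[F1, F0, F0, F0, F0],
     [F0, F1, F0, F0, F0],
     [F0, F0, F0, F0, F2],
     [F0, F0, F1, F0, F1],
     [F0, F0, F0, F1, F1]]
    [(63, [[(F1, F0), (F0, F1), (F1, F0), (F0, F1), (F0, F0)]]),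
     (1, [[(F1, F0), (F0, F1), (F0, F0), (F0, F0), (F0, F0)]])]"

lemma check_64: "check 4 5 lines_64" "length lines_64 = 64"
  by code_simp+

text \<open>Spreads of the five hyperplanes through \<open>E\<close>: such a spread has 17 lines in its own hyperplane
  and one line in every other hyperplane. Four copies of the system above leave the hyperplanes
  through \<open>E\<close> empty, which makes room for the 17 lines.\<close>

definition solid_spread :: "column list list" where
  "solid_spread = orbits
    [[F0, F0, F0, F0, F2],
     [F0, F0, F0, F0, F0],
     [F1, F0, F0, F0, F0],
     [F0, F0, F1, F0, F1],
     [F0, F0, F0, F1, F1]]
    [(17, [[(F1, F3), (F0, F0), (F0, F2), (F0, F2), (F0, F3)]])]"

text \<open>The matrix fixes \<open>E\<close> pointwise and permutes the five hyperplanes through it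
  cyclically, so for \<open>k\<close> up to 5 it moves the one given spread to \<open>k\<close> of
  them.\<close>

definition pencil_spreads :: "nat \<Rightarrow> column list list" where
  "pencil_spreads k = concat (map (orbit k
    [[F0, F2, F0, F0, F0],
     [F1, F1, F0, F0, F0],
     [F0, F0, F1, F0, F0],
     [F0, F0, F0, F1, F0],
     [F0, F0, F0, F0, F1]]) solid_spread)"

definition lines_with_spreads :: "nat \<Rightarrow> column list list" where
  "lines_with_spreads k = lines_64 @ lines_64 @ lines_64 @ lines_64 @ pencil_spreads k"

text \<open>A hyperplane not through \<open>E\<close> contains 16 lines of the four copies and one
  line of each spread; a hyperplane through \<open>E\<close> whose spread is present contains its 17
  lines and one of each other spread. Either way the count is 16 + k.\<close>

lemma check_spreads:
  "check 17 5 (lines_with_spreads 1)" "length (lines_with_spreads 1) = 273"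
  "check 18 5 (lines_with_spreads 2)" "length (lines_with_spreads 2) = 290"
  "check 19 5 (lines_with_spreads 3)" "length (lines_with_spreads 3) = 307"
  "check 20 5 (lines_with_spreads 4)" "length (lines_with_spreads 4) = 324"
  "check 21 5 (lines_with_spreads 5)" "length (lines_with_spreads 5) = 341"
  by code_simp+

section \<open>The exact values and bounds\<close>

definition attainable :: "'q::{field,finite} itself \<Rightarrow> nat \<Rightarrow> nat \<Rightarrow> bool" where
  "attainable _ s m \<longleftrightarrow> (\<exists>ls :: (('q ^ 5) \<times> ('q ^ 5)) list. length ls = m \<and> line_system s ls)"

lemma attainable_add:
  "attainable T s m \<Longrightarrow> attainable T s' m' \<Longrightarrow> attainable T (s + s') (m + m')"
  unfolding attainable_def using line_system_append by (metis length_append)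

lemma attainable_add_multiple:
  assumes "attainable T s m" "attainable T s' m'"
  shows "attainable T (s + s' * k) (m + m' * k)"
proof (induction k)
  case 0
  then show ?case using assms(1) by simp
next
  case (Suc k)
  then show ?case
    using attainable_add[OF Suc assms(2)] by (simp add: algebra_simps)
qed

lemma attainable_of_check:
  assumes "CARD('q::{field,finite}) = 4" "check s 5 ls" "length ls = m"
  shows "attainable TYPE('q) s m"
proof -
  have "check s CARD(5) ls"
    using assms(2) by simp
  from line_system_of_check[OF assms(1) this] show ?thesis
    unfolding attainable_def assms(3)[symmetric] by metis
qed

lemma max_system_size_between:
  assumes q: "CARD('q::{field,finite}) = 4" and "attainable TYPE('q) s m" "s \<le> m"
    and upper: "\<And>ls :: (('q ^ 5) \<times> ('q ^ 5)) list. line_system s ls \<Longrightarrow> \<forall>l\<in>set ls. independent_pair l \<Longrightarrow> length ls \<le> u"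
  shows "m \<le> max_system_size TYPE('q) TYPE(5) 2 s \<and> max_system_size TYPE('q) TYPE(5) 2 s \<le> u"
proof -
  obtain ls :: "(('q ^ 5) \<times> ('q ^ 5)) list" where ls: "length ls = m" "line_system s ls"
    using assms(2) by (auto simp: attainable_def)
  let ?M = "mset (map (\<lambda>l. vec.span {fst l, snd l}) ls)"
  have "size N \<le> u" if N: "bounded_system 2 s N" for N :: "('q ^ 5) set multiset"
  proof -
    have "2 \<le> CARD(5)"
      by simp
    then obtain ls :: "(('q ^ 5) \<times> ('q ^ 5)) list"
      where "length ls = size N" "line_system s ls" "\<forall>l\<in>set ls. independent_pair l"
      using lines_of_bounded_system[OF _ N] by blast
    then show ?thesis
      using upper by metis
  qed
  then show ?thesis
    using max_system_size_bounds[of 2 s u ?M] bounded_system_of_lines[OF ls(2)] ls(1) assms(3) by simp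
qed

text \<open>A certificate that \<open>c1\<close> is at most \<open>b\<close>: otherwise
  \<open>4 * x \<le> b < c1 \<le> 4 * c2\<close> gives \<open>x < c2\<close>, likewise
  \<open>y < c3\<close>, and the three terms add up to more than \<open>5 * s\<close>. In the
  applications \<open>x\<close> and \<open>y\<close> are the integer parts of \<open>b / 4\<close>
  and \<open>x / 4\<close>.\<close>

lemma max_system_size_griesmer:
  assumes q: "CARD('q::{field,finite}) = 4" and "attainable TYPE('q) s m" "s \<le> m"
    and arith: "4 * x \<le> b" "4 * y \<le> x" "5 * s < b + x + y + 3"
  shows "m \<le> max_system_size TYPE('q) TYPE(5) 2 s \<and> max_system_size TYPE('q) TYPE(5) 2 s \<le> s + 4 * b"
proof (rule max_system_size_between[OF assms(1-3)])
  fix ls :: "(('q ^ 5) \<times> ('q ^ 5)) list"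
  assume ls: "line_system s ls"
  have "CARD(5) = 5"
    by simp
  then obtain c1 c2 c3 where c: "length ls \<le> s + 4 * c1" "c1 \<le> 4 * c2" "c2 \<le> 4 * c3" "c1 + c2 + c3 \<le> 5 * s"
    using length_line_system_griesmer[OF q _ ls] by blast
  have "c1 \<le> b"
  proof (rule ccontr)
    assume "\<not> c1 \<le> b"
    then have "b < c1"
      by simp
    moreover from this have "x < c2"
      using c(2) arith(1) by linarith
    moreover from this have "y < c3"
      using c(3) arith(2) by linarith
    ultimately show False
      using c(4) arith(3) by linarith
  qed
  with c(1) show "length ls \<le> s + 4 * b"
    by linarith
qed

theorem theorem6:
  fixes n :: "nat \<Rightarrow> nat"
  assumes "CARD('q::{field,finite}) = 4"
    and "\<And>s. n s = max_system_size TYPE('q) TYPE(5) 2 s"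
  shows "(20 \<le> n 2 \<and> n 2 \<le> 22 \<and>
         39 \<le> n 3 \<and> n 3 \<le> 42 \<and>
         n 4 = 64 \<and>
         75 \<le> n 5 \<and> n 5 \<le> 77 \<and>
         90 \<le> n 6 \<and> n 6 \<le> 94 \<and>
         107 \<le> n 7 \<and> n 7 \<le> 111 \<and>
         n 8 = 128 \<and>
         n 9 = 141 \<and>
         156 \<le> n 10 \<and> n 10 \<le> 158 \<and>
         n 11 = 175 \<and>
         n 12 = 192 \<and>
         n 13 = 205 \<and>
         n 14 = 222 \<and>
         n 15 = 239 \<and>
         n 16 = 256 \<and>
         n 17 = 273 \<and>
         n 18 = 290 \<and>
         n 19 = 307 \<and>
         n 20 = 324 \<and>
         n 21 = 341) \<and>
         (\<forall>t::nat. t \<ge> 2 \<longrightarrow>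
         n (21 * t - 20) = 341 * t - 328 \<and>
         n (21 * t - 19) = 341 * t - 311 \<and>
         n (21 * t - 18) = 341 * t - 294 \<and>
         n (21 * t - 17) = 341 * t - 277 \<and>
         n (21 * t - 16) = 341 * t - 264 \<and>
         n (21 * t - 15) = 341 * t - 247 \<and>
         n (21 * t - 14) = 341 * t - 230 \<and>
         n (21 * t - 13) = 341 * t - 213 \<and>
         n (21 * t - 12) = 341 * t - 200 \<and>
         n (21 * t - 11) = 341 * t - 183 \<and>
         n (21 * t - 10) = 341 * t - 166 \<and>
         n (21 * t - 9) = 341 * t - 149 \<and>
         n (21 * t - 8) = 341 * t - 136 \<and>
         n (21 * t - 7) = 341 * t - 119 \<and>
         n (21 * t - 6) = 341 * t - 102 \<and>
         n (21 * t - 5) = 341 * t - 85 \<and>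
         n (21 * t - 4) = 341 * t - 68 \<and>
         n (21 * t - 3) = 341 * t - 51 \<and>
         n (21 * t - 2) = 341 * t - 34 \<and>
         n (21 * t - 1) = 341 * t - 17 \<and>
         n (21 * t) = 341 * t)"
proof -
  note att = attainable_of_check[OF assms(1)]
  note add = attainable_add[of "TYPE('q)"]
  have a: "attainable TYPE('q) 2 20" "attainable TYPE('q) 3 39" "attainable TYPE('q) 4 64"
    "attainable TYPE('q) 5 75" "attainable TYPE('q) 6 90" "attainable TYPE('q) 7 107"
    "attainable TYPE('q) 9 141" "attainable TYPE('q) 10 156" "attainable TYPE('q) 11 175"
    "attainable TYPE('q) 14 222" "attainable TYPE('q) 17 273" "attainable TYPE('q) 18 290"
    "attainable TYPE('q) 19 307" "attainable TYPE('q) 20 324" "attainable TYPE('q) 21 341"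
    by (rule att[OF check_20] att[OF check_39] att[OF check_64] att[OF check_75] att[OF check_90]
      att[OF check_107] att[OF check_141] att[OF check_156] att[OF check_175] att[OF check_222]
      att[OF check_spreads(1,2)] att[OF check_spreads(3,4)] att[OF check_spreads(5,6)]
      att[OF check_spreads(7,8)] att[OF check_spreads(9,10)])+
  have b: "attainable TYPE('q) 8 128" "attainable TYPE('q) 12 192" "attainable TYPE('q) 13 205"
    "attainable TYPE('q) 15 239" "attainable TYPE('q) 16 256"
    using add[OF a(3) a(3)] add[OF add[OF a(3) a(3)] a(3)] add[OF a(7) a(3)] add[OF a(9) a(3)]
      add[OF add[OF a(3) a(3)] add[OF a(3) a(3)]] by simp_all
  \<comment> \<open>For s = 21 + r with r = 1, 2, 3, 5, 6, 7, 10, adding 341 lines to a system above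
    for r falls short or no such system is given. Here other sums reach the bound: 18 + 4, 19 + 4,
    20 + 4, 18 + 8, 19 + 8, 20 + 8 and 20 + 11.\<close>
  have c: "attainable TYPE('q) 22 354" "attainable TYPE('q) 23 371" "attainable TYPE('q) 24 388"
    "attainable TYPE('q) 25 405" "attainable TYPE('q) 26 418" "attainable TYPE('q) 27 435"
    "attainable TYPE('q) 28 452" "attainable TYPE('q) 29 469" "attainable TYPE('q) 30 482"
    "attainable TYPE('q) 31 499" "attainable TYPE('q) 32 516" "attainable TYPE('q) 33 533"
    "attainable TYPE('q) 34 546" "attainable TYPE('q) 35 563" "attainable TYPE('q) 36 580"
    "attainable TYPE('q) 37 597" "attainable TYPE('q) 38 614" "attainable TYPE('q) 39 631"
    "attainable TYPE('q) 40 648" "attainable TYPE('q) 41 665" "attainable TYPE('q) 42 682"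
    using add[OF a(12) a(3)] add[OF a(13) a(3)] add[OF a(14) a(3)] add[OF a(15) a(3)]
      add[OF a(12) b(1)] add[OF a(13) b(1)] add[OF a(14) b(1)] add[OF a(15) b(1)]
      add[OF a(15) a(7)] add[OF a(14) a(9)] add[OF a(15) a(9)] add[OF a(15) b(2)]
      add[OF a(15) b(3)] add[OF a(15) a(10)] add[OF a(15) b(4)] add[OF a(15) b(5)]
      add[OF a(15) a(11)] add[OF a(15) a(12)] add[OF a(15) a(13)] add[OF a(15) a(14)]
      add[OF a(15) a(15)] by simp_all
  note bound = max_system_size_griesmer[OF assms(1), folded assms(2)]
  have 2: "20 \<le> n 2 \<and> n 2 \<le> 22"
    unfolding assms(2)
  proof (rule max_system_size_between[OF assms(1) a(1)])
    fix ls :: "(('q ^ 5) \<times> ('q ^ 5)) list"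
    assume "line_system 2 ls" "\<forall>l\<in>set ls. independent_pair l"
    then show "length ls \<le> 22"
      using length_line_system_le_21[of ls 2] assms(1) by (cases "ls = []") auto
  qed simp
  have 3: "39 \<le> n 3 \<and> n 3 \<le> 42"
    unfolding assms(2)
  proof (rule max_system_size_between[OF assms(1) a(2)])
    fix ls :: "(('q ^ 5) \<times> ('q ^ 5)) list"
    assume "line_system 3 ls" "\<forall>l\<in>set ls. independent_pair l"
    then show "length ls \<le> 42"
      using length_line_system_3[of ls] assms(1) by simp
  qed simp
  have 4: "64 \<le> n 4 \<and> n 4 \<le> 64"
    using bound[OF a(3), of 3 15 0] by simp
  have 5: "75 \<le> n 5 \<and> n 5 \<le> 77"
    using bound[OF a(4), of 4 18 1] by simp
  have 6: "90 \<le> n 6 \<and> n 6 \<le> 94"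
    using bound[OF a(5), of 5 22 1] by simp
  have 7: "107 \<le> n 7 \<and> n 7 \<le> 111"
    using bound[OF a(6), of 6 26 1] by simp
  have 8: "128 \<le> n 8 \<and> n 8 \<le> 128"
    using bound[OF b(1), of 7 30 1] by simp
  have 9: "141 \<le> n 9 \<and> n 9 \<le> 141"
    using bound[OF a(7), of 8 33 2] by simp
  have 10: "156 \<le> n 10 \<and> n 10 \<le> 158"
    using bound[OF a(8), of 9 37 2] by simp
  have 11: "175 \<le> n 11 \<and> n 11 \<le> 175"
    using bound[OF a(9), of 10 41 2] by simp
  have 12: "192 \<le> n 12 \<and> n 12 \<le> 192"
    using bound[OF b(2), of 11 45 2] by simp
  have 13: "205 \<le> n 13 \<and> n 13 \<le> 205"
    using bound[OF b(3), of 12 48 3] by simp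
  have 14: "222 \<le> n 14 \<and> n 14 \<le> 222"
    using bound[OF a(10), of 13 52 3] by simp
  have 15: "239 \<le> n 15 \<and> n 15 \<le> 239"
    using bound[OF b(4), of 14 56 3] by simp
  have 16: "256 \<le> n 16 \<and> n 16 \<le> 256"
    using bound[OF b(5), of 15 60 3] by simp
  have 17: "273 \<le> n 17 \<and> n 17 \<le> 273"
    using bound[OF a(11), of 16 64 4] by simp
  have 18: "290 \<le> n 18 \<and> n 18 \<le> 290"
    using bound[OF a(12), of 17 68 4] by simp
  have 19: "307 \<le> n 19 \<and> n 19 \<le> 307"
    using bound[OF a(13), of 18 72 4] by simp
  have 20: "324 \<le> n 20 \<and> n 20 \<le> 324"
    using bound[OF a(14), of 19 76 4] by simp
  have 21: "341 \<le> n 21 \<and> n 21 \<le> 341"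
    using bound[OF a(15), of 20 80 5] by simp
  \<comment> \<open>Everything is reduced to \<open>t = 2\<close>: each further 21 in
    \<open>s\<close> moves the certificate \<open>(b, x, y)\<close> by (80, 20, 5) and adds the
    341-line system once more. The limits on \<open>j\<close> and \<open>i\<close> keep the
    subtractions from truncating.\<close>
  have large: "n (21 * t - j) = 341 * t - i"
    if "2 \<le> t" and att: "attainable TYPE('q) (42 - j) (682 - i)" and "j \<le> 20" "i \<le> 328"
      and b: "682 - i = 42 - j + 4 * b" "4 * x \<le> b" "4 * y \<le> x" "5 * (42 - j) < b + x + y + 3"
    for t j i b x y
  proof -
    define k where "k = t - 2"
    have k: "21 * t - j = 42 - j + 21 * k" "341 * t - i = 682 - i + 341 * k"
      using that(1,3,4) by (auto simp: k_def)
    have "682 - i + 341 * k \<le> n (42 - j + 21 * k) \<and>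
        n (42 - j + 21 * k) \<le> 42 - j + 21 * k + 4 * (b + 80 * k)"
      by (rule bound[OF attainable_add_multiple[OF att a(15)], of k "x + 20 * k" _ "y + 5 * k"])
        (use that(3,4) in linarith, use b(2) in simp, use b(3) in simp, use b(4) in simp)
    moreover have "42 - j + 21 * k + 4 * (b + 80 * k) = 682 - i + 341 * k"
      using b(1) by simp
    ultimately show ?thesis
      unfolding k by simp
  qed
  have t20: "n (21 * t - 20) = 341 * t - 328" if "2 \<le> t" for t
    using large[OF that, of 20 328 83 20 5] c(1) by simp
  have t19: "n (21 * t - 19) = 341 * t - 311" if "2 \<le> t" for t
    using large[OF that, of 19 311 87 21 5] c(2) by simp
  have t18: "n (21 * t - 18) = 341 * t - 294" if "2 \<le> t" for t
    using large[OF that, of 18 294 91 22 5] c(3) by simp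
  have t17: "n (21 * t - 17) = 341 * t - 277" if "2 \<le> t" for t
    using large[OF that, of 17 277 95 23 5] c(4) by simp
  have t16: "n (21 * t - 16) = 341 * t - 264" if "2 \<le> t" for t
    using large[OF that, of 16 264 98 24 6] c(5) by simp
  have t15: "n (21 * t - 15) = 341 * t - 247" if "2 \<le> t" for t
    using large[OF that, of 15 247 102 25 6] c(6) by simp
  have t14: "n (21 * t - 14) = 341 * t - 230" if "2 \<le> t" for t
    using large[OF that, of 14 230 106 26 6] c(7) by simp
  have t13: "n (21 * t - 13) = 341 * t - 213" if "2 \<le> t" for t
    using large[OF that, of 13 213 110 27 6] c(8) by simp
  have t12: "n (21 * t - 12) = 341 * t - 200" if "2 \<le> t" for t
    using large[OF that, of 12 200 113 28 7] c(9) by simp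
  have t11: "n (21 * t - 11) = 341 * t - 183" if "2 \<le> t" for t
    using large[OF that, of 11 183 117 29 7] c(10) by simp
  have t10: "n (21 * t - 10) = 341 * t - 166" if "2 \<le> t" for t
    using large[OF that, of 10 166 121 30 7] c(11) by simp
  have t9: "n (21 * t - 9) = 341 * t - 149" if "2 \<le> t" for t
    using large[OF that, of 9 149 125 31 7] c(12) by simp
  have t8: "n (21 * t - 8) = 341 * t - 136" if "2 \<le> t" for t
    using large[OF that, of 8 136 128 32 8] c(13) by simp
  have t7: "n (21 * t - 7) = 341 * t - 119" if "2 \<le> t" for t
    using large[OF that, of 7 119 132 33 8] c(14) by simp
  have t6: "n (21 * t - 6) = 341 * t - 102" if "2 \<le> t" for t
    using large[OF that, of 6 102 136 34 8] c(15) by simp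
  have t5: "n (21 * t - 5) = 341 * t - 85" if "2 \<le> t" for t
    using large[OF that, of 5 85 140 35 8] c(16) by simp
  have t4: "n (21 * t - 4) = 341 * t - 68" if "2 \<le> t" for t
    using large[OF that, of 4 68 144 36 9] c(17) by simp
  have t3: "n (21 * t - 3) = 341 * t - 51" if "2 \<le> t" for t
    using large[OF that, of 3 51 148 37 9] c(18) by simp
  have t2: "n (21 * t - 2) = 341 * t - 34" if "2 \<le> t" for t
    using large[OF that, of 2 34 152 38 9] c(19) by simp
  have t1: "n (21 * t - 1) = 341 * t - 17" if "2 \<le> t" for t
    using large[OF that, of 1 17 156 39 9] c(20) by simp
  have t0: "n (21 * t) = 341 * t" if "2 \<le> t" for t
    using large[OF that, of 0 0 160 40 10] c(21) by simp
  \<comment> \<open>\<open>One_nat_def\<close> is removed so that the 1 in \<open>21 * t - 1\<close>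
    stays as it is in \<open>t1\<close>.\<close>
  show ?thesis
    using 2 3 4 5 6 7 8 9 10 11 12 13 14 15 16 17 18 19 20 21
    by (intro conjI allI impI) (simp_all del: One_nat_def add: t0 t1 t2 t3 t4 t5 t6 t7 t8 t9 t10 t11 t12 t13 t14 t15 t16 t17 t18 t19 t20)
qed


end
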